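(* For $(x,y)=(x_1,x_2,y)\in\mathbb{R}^3_+$ (i.e. $x\in\mathbb{R}^2$, $y>0$) set $\rho=\sqrt{x_1^2+x_2^2+y^2}$ and, for $(x_1,x_2,y)\neq(0,0,1)$, $$a=\sqrt{\frac{\rho^2-2y+1}{\rho^2+2y+1}},\qquad b=\frac{\rho^2-1}{\sqrt{(\rho^2+1)^2-4y^2}} .$$ Let $P_n$ denote the Legendre polynomial of degree $n$. Then the functions $$u_n(x,y)=\sqrt{\frac{2}{\pi}}\;\frac{a^n\,P_n(b)}{\sqrt{\rho^2+2y+1}}\qquad(n\ge0)$$ (extended by continuity at the point $(0,0,1)$) form an orthonormal system in the Dirichlet space of harmonic functions on $\mathbb{R}^3_+$; that is, each $u_n$ is harmonic on $\mathbb{R}^3_+$ and, for all $m,n\ge0$, $$\iint_{\mathbb{R}^3_+}\frac{\partial u_m}{\partial y}\,\overline{\frac{\partial u_n}{\partial y}}\;dx\,dy=\delta_{m,n}.$$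
   Context: The Dirichlet space on $\mathbb{R}^3_+=\{(x,y):x\in\mathbb{R}^2,\ y>0\}$ is taken here with the (semi)norm $\left(\iint_{\mathbb{R}^3_+}|\partial u/\partial y|^2\,dx\,dy\right)^{1/2}$ and the corresponding inner product. Legendre polynomials are normalized by $\sum_{n\ge0}P_n(b)s^n=(1-2bs+s^2)^{-1/2}$. *)

theory Defs
  imports "HOL-Analysis.Analysis" "HOL-Complex_Analysis.Complex_Analysis"
begin

subsection \<open>Legendre polynomials\<close>

text \<open>
  The \<open>n\<close>-th Legendre polynomial is the coefficient of \<open>s\<^sup>n\<close> in the expansion of
  \<open>(1 - 2 b s + s\<^sup>2)\<^bsup>-1/2\<^esup>\<close>, computed in \<open>\<real>[b][[s]]\<close> as the binomial series of
  \<open>(1 + w)\<^bsup>-1/2\<^esup>\<close> composed with \<open>w = s\<^sup>2 - 2 b s\<close>.  Here \<open>s\<close> is \<^const>\<open>fps_X\<close>, and \<open>2 b\<close> is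
  the polynomial \<open>[:0, 2:]\<close>.
\<close>

definition legendre :: "nat \<Rightarrow> real poly" where
  "legendre n =
     fps_nth (fps_compose (Abs_fps (\<lambda>k. [:(- 1 / 2) gchoose k:]))
                          (fps_X ^ 2 - fps_const [:0, 2:] * fps_X)) n"

lemma legendre_0: "legendre 0 = 1"
  by (simp add: legendre_def one_pCons)

lemma legendre_1: "legendre 1 = [:0, 1:]"
  by (simp add: legendre_def fps_compose_nth)

lemma of_real_poly_legendre:
  "complex_of_real (poly (legendre n) b) =
     fps_nth (fps_compose (fps_binomial (- 1 / 2))
                          (fps_X ^ 2 - fps_const (2 * complex_of_real b) * fps_X)) n"
proof -
  define h :: "real poly fps \<Rightarrow> complex fps"
    where "h f = Abs_fps (\<lambda>n. complex_of_real (poly (fps_nth f n) b))" for f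
  define w :: "real poly fps" where "w = fps_X ^ 2 - fps_const [:0, 2:] * fps_X"
  have h_mult: "h (f * g) = h f * h g" for f g
    by (simp add: h_def fps_eq_iff fps_mult_nth poly_sum)
  have h_power: "h (f ^ k) = h f ^ k" for f k
    by (induction k) (simp_all add: h_mult, simp add: h_def fps_eq_iff)
  have h_w: "h w = fps_X ^ 2 - fps_const (2 * complex_of_real b) * fps_X"
    by (auto simp: h_def w_def fps_eq_iff fps_X_power_nth)
  have gc: "complex_of_real (a gchoose k) = complex_of_real a gchoose k" for a k
    by (simp add: gbinomial_prod_rev)
  have "complex_of_real (poly (legendre n) b) =
          (\<Sum>k=0..n. complex_of_real ((- 1 / 2) gchoose k) * fps_nth (h (w ^ k)) n)"
    by (simp add: legendre_def fps_compose_nth poly_sum h_def w_def)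
  also have "\<dots> = fps_nth (fps_compose (fps_binomial (- 1 / 2)) (h w)) n"
    by (simp add: h_power fps_compose_nth gc)
  finally show ?thesis by (simp add: h_w)
qed

lemma legendre_generating_function:
  fixes b :: real
  shows "eventually (\<lambda>s. (\<lambda>n. poly (legendre n) b * s ^ n) sums (1 - 2 * b * s + s ^ 2) powr (- 1 / 2)) (nhds 0)"
proof -
  define g where "g = (\<lambda>z. z ^ 2 - 2 * complex_of_real b * z)"
  define G where "G = fps_X ^ 2 - fps_const (2 * complex_of_real b) * fps_X"
  define F where "F = fps_compose (fps_binomial (- 1 / 2)) G"
  have gG: "g has_fps_expansion G"
    unfolding g_def G_def by (intro fps_expansion_intros)
  have "((\<lambda>x. (1 + x) powr (- 1 / 2)) \<circ> g) has_fps_expansion F"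
    unfolding F_def
    by (intro has_fps_expansion_compose has_fps_expansion_binomial_complex gG) (simp add: G_def)
  then have rad: "fps_conv_radius F > 0"
    and ev: "eventually (\<lambda>z. eval_fps F z = (1 + g z) powr (- 1 / 2)) (nhds 0)"
    by (auto simp: has_fps_expansion_def)
  have "eventually (\<lambda>z. z \<in> eball 0 (fps_conv_radius F)) (nhds (0::complex))"
    using rad by (intro eventually_nhds_in_open) (auto simp: zero_ereal_def)
  with ev have "eventually (\<lambda>z. (\<lambda>n. fps_nth F n * z ^ n) sums (1 + g z) powr (- 1 / 2)) (nhds 0)"
  proof eventually_elim
    case (elim z)
    then show ?case
      using sums_eval_fps[of z F] by (simp add: in_eball_iff)
  qed
  moreover have "filterlim complex_of_real (nhds 0) (nhds 0)"
    using tendsto_of_real[OF filterlim_ident, of 0] by simp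
  ultimately have 1: "eventually (\<lambda>s. (\<lambda>n. fps_nth F n * complex_of_real s ^ n) sums
                     (1 + g (complex_of_real s)) powr (- 1 / 2)) (nhds 0)"
    by (rule eventually_compose_filterlim)
  have "((\<lambda>s. 1 - 2 * b * s + s ^ 2) \<longlongrightarrow> 1 - 2 * b * 0 + 0 ^ 2) (nhds 0)"
    by (intro tendsto_intros filterlim_ident)
  then have "eventually (\<lambda>s. 1 - 2 * b * s + s ^ 2 > 0) (nhds 0)"
    by (rule order_tendstoD) simp
  with 1 show ?thesis
  proof eventually_elim
    case (elim s)
    have *: "1 + g (complex_of_real s) = complex_of_real (1 - 2 * b * s + s ^ 2)"
      by (simp add: g_def)
    have "(1 + g (complex_of_real s)) powr (- 1 / 2) =
            complex_of_real ((1 - 2 * b * s + s ^ 2) powr (- 1 / 2))"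
      unfolding * using elim(2) powr_of_real[of "1 - 2 * b * s + s ^ 2" "- 1 / 2"] by simp
    with elim(1) have "(\<lambda>n. complex_of_real (poly (legendre n) b * s ^ n)) sums
                         complex_of_real ((1 - 2 * b * s + s ^ 2) powr (- 1 / 2))"
      by (simp add: of_real_poly_legendre F_def G_def)
    then show ?case by (simp only: sums_of_real_iff)
  qed
qed


subsection \<open>Harmonic functions\<close>

definition dir_deriv ::
  "'a::real_normed_vector \<Rightarrow> ('a \<Rightarrow> 'b::real_normed_vector) \<Rightarrow> 'a \<Rightarrow> 'b" where
  "dir_deriv v f z = vector_derivative (\<lambda>t. f (z + t *\<^sub>R v)) (at 0)"

definition C1_on :: "'a::euclidean_space set \<Rightarrow> ('a \<Rightarrow> 'b::real_normed_vector) \<Rightarrow> bool" where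
  "C1_on S f \<longleftrightarrow>
     continuous_on S f \<and>
     (\<forall>i\<in>Basis. (\<forall>z\<in>S. (\<lambda>t. f (z + t *\<^sub>R i)) differentiable (at 0)) \<and>
                continuous_on S (dir_deriv i f))"

definition C2_on :: "'a::euclidean_space set \<Rightarrow> ('a \<Rightarrow> 'b::real_normed_vector) \<Rightarrow> bool" where
  "C2_on S f \<longleftrightarrow> C1_on S f \<and> (\<forall>i\<in>Basis. C1_on S (dir_deriv i f))"

definition laplacian :: "('a::euclidean_space \<Rightarrow> 'b::real_normed_vector) \<Rightarrow> 'a \<Rightarrow> 'b" where
  "laplacian f z = (\<Sum>i\<in>Basis. dir_deriv i (dir_deriv i f) z)"

definition harmonic_on :: "'a::euclidean_space set \<Rightarrow> ('a \<Rightarrow> 'b::real_normed_vector) \<Rightarrow> bool" where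
  "harmonic_on S f \<longleftrightarrow> open S \<and> C2_on S f \<and> (\<forall>z\<in>S. laplacian f z = 0)"


subsection \<open>The Dirichlet space of the upper half-space\<close>

text \<open>Points of \<open>\<real>\<^sup>3\<close> are triples \<open>(x\<^sub>1, x\<^sub>2, y)\<close>; the norm of this type is the Euclidean one.\<close>

type_synonym R3 = "real \<times> real \<times> real"

definition half_space :: "R3 set" where
  "half_space = {(x1, x2, y). y > 0}"

definition dy :: "(R3 \<Rightarrow> complex) \<Rightarrow> R3 \<Rightarrow> complex" where
  "dy = dir_deriv (0, 0, 1)"

definition dirichlet_space :: "(R3 \<Rightarrow> complex) set" where
  "dirichlet_space =
     {f. harmonic_on half_space f \<and>
         set_integrable lborel half_space (\<lambda>z. (cmod (dy f z))\<^sup>2)}"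

definition dirichlet_inner :: "(R3 \<Rightarrow> complex) \<Rightarrow> (R3 \<Rightarrow> complex) \<Rightarrow> complex" where
  "dirichlet_inner f g = (LINT z:half_space|lborel. dy f z * cnj (dy g z))"


subsection \<open>The functions \<open>u\<^sub>n\<close>\<close>

definition rho :: "R3 \<Rightarrow> real" where
  "rho = (\<lambda>(x1, x2, y). sqrt (x1\<^sup>2 + x2\<^sup>2 + y\<^sup>2))"

definition a_fun :: "R3 \<Rightarrow> real" where
  "a_fun = (\<lambda>(x1, x2, y). sqrt (((rho (x1, x2, y))\<^sup>2 - 2 * y + 1) / ((rho (x1, x2, y))\<^sup>2 + 2 * y + 1)))"

definition b_fun :: "R3 \<Rightarrow> real" where
  "b_fun = (\<lambda>(x1, x2, y). ((rho (x1, x2, y))\<^sup>2 - 1) / sqrt (((rho (x1, x2, y))\<^sup>2 + 1)\<^sup>2 - 4 * y\<^sup>2))"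

definition u_formula :: "nat \<Rightarrow> R3 \<Rightarrow> real" where
  "u_formula n = (\<lambda>(x1, x2, y).
     sqrt (2 / pi) * ((a_fun (x1, x2, y)) ^ n * poly (legendre n) (b_fun (x1, x2, y)))
       / sqrt ((rho (x1, x2, y))\<^sup>2 + 2 * y + 1))"

text \<open>
  At \<open>(0, 0, 1)\<close> the value is the limit of the formula.  If this limit did not exist, the value
  would be unspecified and the function discontinuous there, so harmonicity of \<open>u n\<close>
  on the half-space includes the existence of the extension.
\<close>

definition u :: "nat \<Rightarrow> R3 \<Rightarrow> complex" where
  "u n z = complex_of_real
     (if z = (0, 0, 1) then Lim (at (0, 0, 1)) (u_formula n) else u_formula n z)"

end

(* The generating function of the u_n is the potential of a point charge: with q = 1 - s and p = 1 + s,
   sum_n u_n s^n = sqrt (2 / pi) * W^(-1/2),  W = q^2 (x1^2 + x2^2) + (q y + p)^2 = (1 - s)^2 (r^2 + (y + c)^2),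
   where r^2 = x1^2 + x2^2 and c = (1 + s) / (1 - s).
   Harmonicity is read off coefficientwise: W is a sum of squares of affine forms, and the formal series
   G with W G^2 = 1 can be differentiated as in the scalar case.
   For orthonormality, the y-derivative of the generating function is a multiple of the Poisson kernel at
   height y + c.  The integral of the product of two such derivatives is (pi / 2) / (1 - s t) for
   parameters s and t, because for d = (1 + t) / (1 - t) the kernels with c and d contribute
   pi / (c + d).  The bound |d/dy W^(-1/2)|_n <= 24^n / (r^2 + (y + 1)^2) on the coefficients
   allows sum and integral to be interchanged, and comparing coefficients of s^m t^n gives the result. *)

theory Submission
  imports Defs "HOL-Real_Asymp.Real_Asymp"
begin

subsection \<open>Coefficientwise calculus of formal power series\<close>

text \<open>The obstacle is the point (0, 0, 1): there a vanishes without being differentiable and b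
  has no limit, so the formula for u_n cannot be differentiated as it stands. Homogenizing removes
  this: a^n P_n(b) is the coefficient of s^n in (1 - 2 \<alpha> s + \<beta> s^2)^(-1/2) with
  \<alpha> = a b and \<beta> = a^2, and these two extend to rational functions whose denominator,
  the squared distance to (0, 0, -1), is positive on the half-space. Harmonicity is treated formally
  because every coefficient of a product or composition is a finite expression in the given
  coefficients, so it can be differentiated without any question of convergence. Convergence enters
  only with the integrals, and there only on a small interval of parameters that is the same for all
  points; hence crude coefficient bounds suffice. Orthogonality comes from 1 / (1 - s t) being a
  series in the product s t alone: only the terms s^n t^n occur.\<close>

definition has_coeff_deriv :: "(real \<Rightarrow> real fps) \<Rightarrow> real fps \<Rightarrow> bool" where
  "has_coeff_deriv f f' \<longleftrightarrow>
     (\<forall>n. ((\<lambda>t. fps_nth (f t) n) has_real_derivative fps_nth f' n) (at 0))"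

lemma has_coeff_deriv_unique:
  "has_coeff_deriv f f' \<Longrightarrow> has_coeff_deriv f f'' \<Longrightarrow> f' = f''"
  unfolding has_coeff_deriv_def fps_eq_iff by (meson DERIV_unique)

lemma has_coeff_deriv_const: "has_coeff_deriv (\<lambda>_. c) 0"
  by (simp add: has_coeff_deriv_def)

lemma has_coeff_deriv_fps_const:
  "(f has_real_derivative f') (at 0) \<Longrightarrow> has_coeff_deriv (\<lambda>t. fps_const (f t)) (fps_const f')"
  by (auto simp: has_coeff_deriv_def)

lemma has_coeff_deriv_add:
  "has_coeff_deriv f f' \<Longrightarrow> has_coeff_deriv g g' \<Longrightarrow> has_coeff_deriv (\<lambda>t. f t + g t) (f' + g')"
  by (auto simp: has_coeff_deriv_def intro!: DERIV_add)

lemma has_coeff_deriv_minus: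
  "has_coeff_deriv f f' \<Longrightarrow> has_coeff_deriv (\<lambda>t. - f t) (- f')"
  by (auto simp: has_coeff_deriv_def intro!: DERIV_minus)

lemma has_coeff_deriv_diff:
  "has_coeff_deriv f f' \<Longrightarrow> has_coeff_deriv g g' \<Longrightarrow> has_coeff_deriv (\<lambda>t. f t - g t) (f' - g')"
  by (auto simp: has_coeff_deriv_def intro!: DERIV_diff)

lemma has_coeff_deriv_mult:
  assumes "has_coeff_deriv f f'" "has_coeff_deriv g g'"
  shows "has_coeff_deriv (\<lambda>t. f t * g t) (f' * g 0 + f 0 * g')"
  unfolding has_coeff_deriv_def
proof
  fix n
  have "((\<lambda>t. \<Sum>i=0..n. fps_nth (f t) i * fps_nth (g t) (n - i)) has_real_derivative
          (\<Sum>i=0..n. fps_nth f' i * fps_nth (g 0) (n - i) + fps_nth g' (n - i) * fps_nth (f 0) i)) (at 0)"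
    using assms unfolding has_coeff_deriv_def by (intro DERIV_sum DERIV_mult) auto
  then show "((\<lambda>t. fps_nth (f t * g t) n) has_real_derivative fps_nth (f' * g 0 + f 0 * g') n) (at 0)"
    by (simp add: fps_mult_nth sum.distrib mult.commute[of "fps_nth g' _"])
qed

lemma has_coeff_deriv_power:
  assumes "has_coeff_deriv f f'"
  shows "has_coeff_deriv (\<lambda>t. f t ^ k) (of_nat k * f 0 ^ (k - 1) * f')"
proof (induction k)
  case 0
  show ?case using has_coeff_deriv_const[of 1] by simp
next
  case (Suc k)
  have "f' * f 0 ^ k + f 0 * (of_nat k * f 0 ^ (k - 1) * f') =
        of_nat (Suc k) * f 0 ^ (Suc k - 1) * f'"
    by (cases k) (simp_all add: algebra_simps)
  with has_coeff_deriv_mult[OF assms Suc] show ?case by simp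
qed

text \<open>The identities to be differentiated hold only on the half-space, so along a line they
  are available only for t near 0.\<close>

lemma has_coeff_deriv_cong:
  assumes "has_coeff_deriv f f'" "eventually (\<lambda>t. f t = g t) (at 0)" "f 0 = g 0"
  shows "has_coeff_deriv g f'"
  unfolding has_coeff_deriv_def
proof
  fix n
  have "((\<lambda>t. fps_nth (f t) n) has_real_derivative fps_nth f' n) (at 0)"
    using assms(1) by (simp add: has_coeff_deriv_def)
  moreover have "eventually (\<lambda>t. fps_nth (f t) n = fps_nth (g t) n) (nhds 0)"
    using assms(2,3) by (auto simp: eventually_at_filter elim!: eventually_mono)
  ultimately show "((\<lambda>t. fps_nth (g t) n) has_real_derivative fps_nth f' n) (at 0)"
    using DERIV_cong_ev[OF refl _ refl, of "\<lambda>t. fps_nth (f t) n" "\<lambda>t. fps_nth (g t) n" 0] by blast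
qed

text \<open>Each coefficient of the composition is a finite sum over powers of the inner series.
  Only existence is claimed: the value of the derivative is found later from an algebraic
  identity.\<close>

lemma has_coeff_deriv_compose:
  assumes "has_coeff_deriv f f'"
  obtains h' where "has_coeff_deriv (\<lambda>t. fps_compose c (f t)) h'"
proof
  show "has_coeff_deriv (\<lambda>t. fps_compose c (f t))
          (Abs_fps (\<lambda>n. \<Sum>k=0..n. fps_nth c k * fps_nth (of_nat k * f 0 ^ (k - 1) * f') n))"
    using has_coeff_deriv_power[OF assms]
    unfolding has_coeff_deriv_def fps_compose_nth
    by (auto intro!: DERIV_sum DERIV_cmult)
qed

definition coeffwise_continuous_on :: "'a::topological_space set \<Rightarrow> ('a \<Rightarrow> real fps) \<Rightarrow> bool" where
  "coeffwise_continuous_on S f \<longleftrightarrow> (\<forall>n. continuous_on S (\<lambda>z. fps_nth (f z) n))"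

lemma coeffwise_continuous_on_const: "coeffwise_continuous_on S (\<lambda>_. c)"
  by (simp add: coeffwise_continuous_on_def)

lemma coeffwise_continuous_on_fps_const:
  assumes "continuous_on S f"
  shows "coeffwise_continuous_on S (\<lambda>z. fps_const (f z))"
  unfolding coeffwise_continuous_on_def
proof
  fix n show "continuous_on S (\<lambda>z. fps_nth (fps_const (f z)) n)" by (cases n) (simp_all add: assms)
qed

lemma coeffwise_continuous_on_add:
  "coeffwise_continuous_on S f \<Longrightarrow> coeffwise_continuous_on S g \<Longrightarrow>
   coeffwise_continuous_on S (\<lambda>z. f z + g z)"
  by (auto simp: coeffwise_continuous_on_def intro!: continuous_intros)

lemma coeffwise_continuous_on_diff:
  "coeffwise_continuous_on S f \<Longrightarrow> coeffwise_continuous_on S g \<Longrightarrow>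
   coeffwise_continuous_on S (\<lambda>z. f z - g z)"
  by (auto simp: coeffwise_continuous_on_def intro!: continuous_intros)

lemma coeffwise_continuous_on_mult:
  "coeffwise_continuous_on S f \<Longrightarrow> coeffwise_continuous_on S g \<Longrightarrow>
   coeffwise_continuous_on S (\<lambda>z. f z * g z)"
  by (auto simp: coeffwise_continuous_on_def fps_mult_nth intro!: continuous_intros)

lemma coeffwise_continuous_on_power:
  "coeffwise_continuous_on S f \<Longrightarrow> coeffwise_continuous_on S (\<lambda>z. f z ^ k)"
  by (induction k) (auto intro: coeffwise_continuous_on_const coeffwise_continuous_on_mult)

lemma coeffwise_continuous_on_compose:
  assumes "coeffwise_continuous_on S f"
  shows "coeffwise_continuous_on S (\<lambda>z. fps_compose c (f z))"
  using coeffwise_continuous_on_power[OF assms]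
  by (auto simp: coeffwise_continuous_on_def fps_compose_nth intro!: continuous_intros)

lemmas coeffwise_continuous_intros =
  coeffwise_continuous_on_const coeffwise_continuous_on_fps_const coeffwise_continuous_on_add
  coeffwise_continuous_on_diff coeffwise_continuous_on_mult coeffwise_continuous_on_power
  coeffwise_continuous_on_compose

subsection \<open>The homogenized Legendre generating function\<close>

text \<open>Replacing s by a s in the Legendre generating function gives
  \<open>\<alpha> = a * b\<close> and \<open>\<beta> = a\<^sup>2\<close>; with independent
  parameters no division by a is ever needed.\<close>

definition legendre_fps :: "real \<Rightarrow> real \<Rightarrow> real fps" where
  "legendre_fps \<alpha> \<beta> = fps_compose (fps_binomial (- 1 / 2)) (fps_const \<beta> * fps_X ^ 2 - fps_const (2 * \<alpha>) * fps_X)"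

text \<open>The square of the binomial series with exponent -1/2 is the inverse of 1 + X, and
  composition with a series without constant term respects products.\<close>

lemma legendre_fps_square:
  "(1 - fps_const (2 * \<alpha>) * fps_X + fps_const \<beta> * fps_X ^ 2) * legendre_fps \<alpha> \<beta> ^ 2 = 1"
proof -
  define w :: "real fps" where "w = fps_const \<beta> * fps_X ^ 2 - fps_const (2 * \<alpha>) * fps_X"
  have w0: "fps_nth w 0 = 0" by (simp add: w_def)
  have "fps_binomial (- 1 / 2 :: real) ^ 2 * (1 + fps_X) = inverse (1 + fps_X) * (1 + fps_X)"
    by (simp add: fps_binomial_power flip: fps_binomial_minus_one)
  also have "\<dots> = 1" by (rule inverse_mult_eq_1) simp
  finally have "fps_compose (fps_binomial (- 1 / 2 :: real) ^ 2 * (1 + fps_X)) w = 1"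
    by simp
  then have "legendre_fps \<alpha> \<beta> ^ 2 * (1 + w) = 1"
    using w0 by (simp add: legendre_fps_def fps_compose_mult_distrib fps_compose_power
        fps_compose_add_distrib w_def[symmetric])
  then show ?thesis by (simp add: w_def algebra_simps)
qed

lemma legendre_fps_nth_0: "fps_nth (legendre_fps \<alpha> \<beta>) 0 = 1"
  by (simp add: legendre_fps_def fps_compose_nth)

text \<open>Bonnet's recurrence in homogenized form. Differentiating \<open>w * B ^ 2 = 1\<close> in
  s and cancelling B gives w' B + 2 w B' = 0; the recurrence is its n-th coefficient.\<close>

lemma legendre_fps_recurrence:
  "real (Suc n) * fps_nth (legendre_fps \<alpha> \<beta>) (Suc n) =
     real (2 * n + 1) * \<alpha> * fps_nth (legendre_fps \<alpha> \<beta>) n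
     - (if n = 0 then 0 else real n * \<beta> * fps_nth (legendre_fps \<alpha> \<beta>) (n - 1))"
proof -
  define B where "B = legendre_fps \<alpha> \<beta>"
  define w where "w = 1 - fps_const (2 * \<alpha>) * fps_X + fps_const \<beta> * fps_X ^ 2"
  have dw: "fps_deriv w = fps_const (- 2 * \<alpha>) + fps_const (2 * \<beta>) * fps_X"
    unfolding w_def by (simp add: fps_deriv_power power2_eq_square numeral_fps_const)
  have "fps_deriv (w * B ^ 2) = 0"
    using legendre_fps_square[of \<alpha> \<beta>] by (simp add: B_def w_def)
  then have "B * (fps_deriv w * B + 2 * w * fps_deriv B) = 0"
    by (simp add: power2_eq_square algebra_simps)
  moreover have "B \<noteq> 0" using legendre_fps_nth_0[of \<alpha> \<beta>] unfolding B_def by auto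
  ultimately have *: "fps_deriv w * B + 2 * w * fps_deriv B = 0" by simp
  have "fps_deriv w * B + 2 * w * fps_deriv B =
     fps_const (- 2 * \<alpha>) * B + fps_const (2 * \<beta>) * (fps_X * B) + fps_const 2 * fps_deriv B
      - fps_const (4 * \<alpha>) * (fps_X * fps_deriv B) + fps_const (2 * \<beta>) * (fps_X * (fps_X * fps_deriv B))"
  proof -
    have c: "fps_const (- 2 * x) = - (2 * fps_const x)" "fps_const (2 * x) = 2 * fps_const x"
      "fps_const (4 * x) = 4 * fps_const x" "fps_const 2 = 2" for x :: real
      by (simp_all add: numeral_fps_const)
    show ?thesis unfolding dw w_def c by (simp add: algebra_simps power2_eq_square)
  qed
  then have "0 = fps_nth (fps_const (- 2 * \<alpha>) * B + fps_const (2 * \<beta>) * (fps_X * B) + fps_const 2 * fps_deriv B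
      - fps_const (4 * \<alpha>) * (fps_X * fps_deriv B) + fps_const (2 * \<beta>) * (fps_X * (fps_X * fps_deriv B))) n"
    using * by simp
  also have "\<dots> = - 2 * \<alpha> * fps_nth B n + 2 * \<beta> * (if n = 0 then 0 else fps_nth B (n - 1))
      + 2 * (real (Suc n) * fps_nth B (Suc n)) - 4 * \<alpha> * (if n = 0 then 0 else real n * fps_nth B n)
      + 2 * \<beta> * (if n = 0 then 0 else real (n - 1) * fps_nth B (n - 1))"
    by (cases n; cases "n - 1") simp_all
  finally show ?thesis unfolding B_def[symmetric]
    by (cases n) (auto simp: algebra_simps)
qed

text \<open>The ratio 3 comes from the recurrence: (2m + 1) + m \<le> 3 (m + 1).\<close>

lemma abs_legendre_fps_nth_le:
  assumes "\<bar>\<alpha>\<bar> \<le> 1" "\<bar>\<beta>\<bar> \<le> 1"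
  shows "\<bar>fps_nth (legendre_fps \<alpha> \<beta>) n\<bar> \<le> 3 ^ n"
proof (induction n rule: less_induct)
  case (less n)
  show ?case
  proof (cases n)
    case 0
    then show ?thesis by (simp add: legendre_fps_nth_0)
  next
    case (Suc m)
    define b where "b = fps_nth (legendre_fps \<alpha> \<beta>)"
    have IH: "\<bar>b k\<bar> \<le> 3 ^ k" if "k \<le> m" for k
      using less[of k] that Suc by (simp add: b_def)
    have "real (Suc m) * \<bar>b (Suc m)\<bar> = \<bar>real (Suc m) * b (Suc m)\<bar>" by (simp only: abs_mult abs_of_nat)
    also have "\<dots> = \<bar>real (2 * m + 1) * \<alpha> * b m - (if m = 0 then 0 else real m * \<beta> * b (m - 1))\<bar>"
      unfolding b_def legendre_fps_recurrence ..
    also have "\<dots> \<le> real (2 * m + 1) * (1 * 3 ^ m) + real m * (1 * 3 ^ m)"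
    proof -
      have 1: "\<bar>\<alpha>\<bar> * \<bar>b m\<bar> \<le> 1 * 3 ^ m" using IH[of m] assms by (intro mult_mono) auto
      have 2: "\<bar>\<beta>\<bar> * \<bar>b (m - 1)\<bar> \<le> 1 * 3 ^ m"
        using order.trans[OF IH[of "m - 1"] power_increasing[of "m - 1" m "3::real"]] assms
        by (intro mult_mono) auto
      have "\<bar>real (2 * m + 1) * \<alpha> * b m\<bar> \<le> real (2 * m + 1) * (1 * 3 ^ m)"
        using mult_left_mono[OF 1, of "real (2*m+1)"] by (simp add: abs_mult mult.assoc)
      moreover have "\<bar>if m = 0 then 0 else real m * \<beta> * b (m - 1)\<bar> \<le> real m * (1 * 3 ^ m)"
        using mult_left_mono[OF 2, of "real m"] by (simp add: abs_mult mult.assoc)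
      ultimately show ?thesis by linarith
    qed
    also have "\<dots> \<le> real (Suc m) * 3 ^ Suc m" by (simp add: algebra_simps)
    finally show ?thesis unfolding Suc b_def[symmetric]
      by (simp only: mult_le_cancel_left_pos of_nat_0_less_iff zero_less_Suc)
  qed
qed

text \<open>Substituting a X for X multiplies the n-th coefficient by a^n. The comparison is made
  over the complex numbers, where \<open>of_real_poly_legendre\<close> describes the coefficients; h
  is the coefficientwise embedding.\<close>

lemma legendre_fps_nth_eq:
  "fps_nth (legendre_fps (a * b) (a\<^sup>2)) n = a ^ n * poly (legendre n) b"
proof -
  define w :: "complex fps" where "w = fps_X ^ 2 - fps_const (2 * complex_of_real b) * fps_X"
  define W :: "real fps" where "W = fps_const (a\<^sup>2) * fps_X ^ 2 - fps_const (2 * (a * b)) * fps_X"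
  define h :: "real fps \<Rightarrow> complex fps" where "h f = Abs_fps (\<lambda>n. complex_of_real (fps_nth f n))" for f
  define r :: "complex fps" where "r = fps_const (complex_of_real a) * fps_X"
  have r0: "fps_nth r 0 = 0" by (simp add: r_def)
  have h_mult: "h (f * g) = h f * h g" for f g
    by (simp add: h_def fps_eq_iff fps_mult_nth)
  have h_power: "h (f ^ k) = h f ^ k" for f k
    by (induction k) (simp_all add: h_mult, simp add: h_def fps_eq_iff)
  have "h W = fps_compose w r"
  proof -
    have "fps_compose w r = r ^ 2 - fps_const (2 * complex_of_real b) * r"
      using r0 by (simp add: w_def fps_compose_sub_distrib fps_compose_mult_distrib flip: fps_compose_power)
    also have "\<dots> = fps_const ((complex_of_real a)\<^sup>2) * fps_X ^ 2
        - fps_const (2 * (complex_of_real a * complex_of_real b)) * fps_X"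
    proof -
      have "fps_const (2 * complex_of_real b) * r =
          fps_const (2 * (complex_of_real a * complex_of_real b)) * fps_X"
        unfolding r_def by (simp add: fps_eq_iff)
      moreover have "r ^ 2 = fps_const ((complex_of_real a)\<^sup>2) * fps_X ^ 2"
        unfolding r_def by (simp add: power_mult_distrib fps_const_power)
      ultimately show ?thesis by simp
    qed
    also have "\<dots> = h W"
      by (auto simp: h_def W_def fps_eq_iff fps_X_power_nth)
    finally show ?thesis ..
  qed
  then have "h (W ^ k) = fps_compose (w ^ k) r" for k
    using r0 by (simp add: h_power fps_compose_power)
  then have *: "complex_of_real (fps_nth (W ^ k) n) = complex_of_real a ^ n * fps_nth (w ^ k) n" for k
    unfolding h_def r_def fps_compose_linear fps_eq_iff by auto
  have gc: "complex_of_real (a gchoose k) = complex_of_real a gchoose k" for a k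
    by (simp add: gbinomial_prod_rev)
  have "complex_of_real (fps_nth (legendre_fps (a * b) (a\<^sup>2)) n) =
          (\<Sum>k=0..n. complex_of_real ((- 1 / 2) gchoose k) * (complex_of_real a ^ n * fps_nth (w ^ k) n))"
    by (simp add: legendre_fps_def fps_compose_nth flip: W_def *)
  also have "\<dots> = complex_of_real a ^ n * complex_of_real (poly (legendre n) b)"
    unfolding of_real_poly_legendre w_def[symmetric]
    by (simp add: fps_compose_nth gc sum_distrib_left algebra_simps)
  finally show ?thesis by (simp only: of_real_mult[symmetric] of_real_power[symmetric] of_real_eq_iff)
qed

subsection \<open>Harmonicity\<close>

definition pole_dist_sq :: "R3 \<Rightarrow> real" where "pole_dist_sq = (\<lambda>(x1, x2, y). x1\<^sup>2 + x2\<^sup>2 + (y + 1)\<^sup>2)"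
text \<open>This function and the next extend a b and a^2 continuously across (0, 0, 1).\<close>

definition legendre_lin_coeff :: "R3 \<Rightarrow> real" where
  "legendre_lin_coeff z = (case z of (x1, x2, y) \<Rightarrow> (x1\<^sup>2 + x2\<^sup>2 + y\<^sup>2 - 1) / pole_dist_sq z)"
definition legendre_quad_coeff :: "R3 \<Rightarrow> real" where
  "legendre_quad_coeff z = (case z of (x1, x2, y) \<Rightarrow> (x1\<^sup>2 + x2\<^sup>2 + (y - 1)\<^sup>2) / pole_dist_sq z)"

lemma open_half_space: "open half_space"
proof -
  have *: "half_space = {z. snd (snd z) > 0}" by (auto simp: half_space_def)
  show ?thesis unfolding * by (intro open_Collect_less continuous_intros)
qed

lemma pole_dist_sq_pos: "z \<in> half_space \<Longrightarrow> pole_dist_sq z > 0"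
  by (auto simp: half_space_def pole_dist_sq_def intro!: add_nonneg_pos)

text \<open>
  With \<open>s\<close> for \<^term>\<open>fps_X\<close>, the sum of the squares of \<open>lin_fps i z\<close> over the basis
  vectors \<open>i\<close> is \<open>(1 - s)\<^sup>2 (x\<^sub>1\<^sup>2 + x\<^sub>2\<^sup>2) + ((1 - s) y + (1 + s))\<^sup>2\<close>, and half of its
  derivative along \<open>v\<close> is \<open>(1 - s) lin_fps v z\<close>.
\<close>

definition lin_fps :: "R3 \<Rightarrow> R3 \<Rightarrow> real fps" where
  "lin_fps v z = fps_const (v \<bullet> z) * (1 - fps_X) + fps_const (snd (snd v)) * (1 + fps_X)"

text \<open>The formal W^(-1/2), with the constant term of W taken out of the root. Its coefficients
  are the u_n up to the factor sqrt (2 / pi).\<close>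

definition gen_fps :: "R3 \<Rightarrow> real fps" where
  "gen_fps z = fps_const (1 / sqrt (pole_dist_sq z)) * legendre_fps (legendre_lin_coeff z) (legendre_quad_coeff z)"

lemma Basis_R3: "(Basis :: R3 set) = {(1, 0, 0), (0, 1, 0), (0, 0, 1)}"
  by (auto simp: Basis_prod_def zero_prod_def)

text \<open>Expansion of W in powers of s: the outer coefficients are the squared distances to (0,
  0, -1) and (0, 0, 1), the middle one is -2 (\<rho>^2 - 1).\<close>

lemma sum_lin_fps_square_eq:
  assumes "z \<in> half_space"
  shows "(\<Sum>i\<in>Basis. lin_fps i z ^ 2) =
    fps_const (pole_dist_sq z) * (1 - fps_const (2 * legendre_lin_coeff z) * fps_X + fps_const (legendre_quad_coeff z) * fps_X ^ 2)"
proof -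
  obtain x1 x2 y where z: "z = (x1, x2, y)" by (cases z)
  have a: "pole_dist_sq z * legendre_lin_coeff z = x1\<^sup>2 + x2\<^sup>2 + y\<^sup>2 - 1" and b: "pole_dist_sq z * legendre_quad_coeff z = x1\<^sup>2 + x2\<^sup>2 + (y - 1)\<^sup>2"
    using pole_dist_sq_pos[OF assms] by (auto simp: legendre_lin_coeff_def legendre_quad_coeff_def z)
  have one: "1 = fps_const (1 :: real)" by simp
  have *: "fps_const (pole_dist_sq z) * (1 - fps_const (2 * legendre_lin_coeff z) * fps_X + fps_const (legendre_quad_coeff z) * fps_X ^ 2) =
     fps_const (pole_dist_sq z) - 2 * fps_const (pole_dist_sq z * legendre_lin_coeff z) * fps_X + fps_const (pole_dist_sq z * legendre_quad_coeff z) * fps_X ^ 2"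
    by (simp add: algebra_simps numeral_fps_const)
  have D: "fps_const (pole_dist_sq z) = fps_const x1 ^ 2 + fps_const x2 ^ 2 + (fps_const y + 1) ^ 2"
    by (simp add: pole_dist_sq_def z one fps_const_power del: fps_const_1_eq_1)
  have A: "fps_const (pole_dist_sq z * legendre_lin_coeff z) = fps_const x1 ^ 2 + fps_const x2 ^ 2 + fps_const y ^ 2 - 1"
    by (simp add: a one fps_const_power del: fps_const_1_eq_1)
  have B: "fps_const (pole_dist_sq z * legendre_quad_coeff z) = fps_const x1 ^ 2 + fps_const x2 ^ 2 + (fps_const y - 1) ^ 2"
    by (simp add: b one fps_const_power del: fps_const_1_eq_1)
  have "(\<Sum>i\<in>Basis. lin_fps i z ^ 2) = (fps_const x1 * (1 - fps_X)) ^ 2 +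
      ((fps_const x2 * (1 - fps_X)) ^ 2 + (fps_const y * (1 - fps_X) + (1 + fps_X)) ^ 2)"
    by (simp add: Basis_R3 lin_fps_def z)
  also have "\<dots> = fps_const x1 ^ 2 + fps_const x2 ^ 2 + (fps_const y + 1) ^ 2 -
      2 * (fps_const x1 ^ 2 + fps_const x2 ^ 2 + fps_const y ^ 2 - 1) * fps_X +
      (fps_const x1 ^ 2 + fps_const x2 ^ 2 + (fps_const y - 1) ^ 2) * fps_X ^ 2"
    by (simp add: power2_eq_square algebra_simps)
  finally show ?thesis unfolding * unfolding A B unfolding D .
qed

text \<open>This identity replaces the square root: both the derivatives of the series and, up to
  sign, its values are deduced from it.\<close>

lemma gen_fps_square:
  assumes "z \<in> half_space"
  shows "(\<Sum>i\<in>Basis. lin_fps i z ^ 2) * gen_fps z ^ 2 = 1"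
proof -
  define w where "w = 1 - fps_const (2 * legendre_lin_coeff z) * fps_X + fps_const (legendre_quad_coeff z) * fps_X ^ 2"
  define B where "B = legendre_fps (legendre_lin_coeff z) (legendre_quad_coeff z)"
  have "(\<Sum>i\<in>Basis. lin_fps i z ^ 2) * gen_fps z ^ 2 =
     (fps_const (pole_dist_sq z) * fps_const (1 / sqrt (pole_dist_sq z)) ^ 2) * (w * B ^ 2)"
    unfolding sum_lin_fps_square_eq[OF assms] gen_fps_def w_def[symmetric] B_def[symmetric]
    by (simp only: power_mult_distrib mult_ac)
  also have "w * B ^ 2 = 1"
    unfolding w_def B_def by (rule legendre_fps_square)
  also have "fps_const (pole_dist_sq z) * fps_const (1 / sqrt (pole_dist_sq z)) ^ 2 = 1"
    using pole_dist_sq_pos[OF assms] by (simp add: fps_const_power power_divide)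
  finally show ?thesis by simp
qed

lemma gen_fps_nth_0: "fps_nth (gen_fps z) 0 = 1 / sqrt (pole_dist_sq z)"
  by (simp add: gen_fps_def legendre_fps_nth_0)

section \<open>Directional derivatives of the generating series\<close>

lemma eventually_line_in_half_space:
  assumes "z \<in> half_space"
  shows "eventually (\<lambda>t. z + t *\<^sub>R v \<in> half_space) (nhds 0)"
proof -
  have "((\<lambda>t. z + t *\<^sub>R v) \<longlongrightarrow> z + 0 *\<^sub>R v) (nhds 0)"
    by (intro tendsto_intros filterlim_ident)
  from topological_tendstoD[OF this open_half_space] show ?thesis using assms by simp
qed

lemma has_coeff_deriv_lin_fps:
  "has_coeff_deriv (\<lambda>t. lin_fps w (z + t *\<^sub>R v)) (fps_const (w \<bullet> v) * (1 - fps_X))"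
proof -
  have "((\<lambda>t. w \<bullet> (z + t *\<^sub>R v)) has_real_derivative w \<bullet> v) (at 0)"
    by (auto simp: inner_right_distrib intro!: derivative_eq_intros)
  from has_coeff_deriv_add[OF has_coeff_deriv_mult[OF has_coeff_deriv_fps_const[OF this]
        has_coeff_deriv_const] has_coeff_deriv_const]
  show ?thesis unfolding lin_fps_def by simp
qed

lemma lin_fps_eq_sum_Basis:
  "lin_fps v z = (\<Sum>i\<in>Basis. fps_const (i \<bullet> v) * lin_fps i z)"
  by (cases v; cases z)
     (simp add: Basis_R3 lin_fps_def algebra_simps flip: fps_const_add fps_const_mult)

lemma has_coeff_deriv_sum_lin_fps_square:
  "has_coeff_deriv (\<lambda>t. \<Sum>i\<in>Basis. lin_fps i (z + t *\<^sub>R v) ^ 2) (2 * (1 - fps_X) * lin_fps v z)"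
proof -
  have "has_coeff_deriv (\<lambda>t. \<Sum>i\<in>(Basis :: R3 set). lin_fps i (z + t *\<^sub>R v) ^ 2)
     (\<Sum>i\<in>Basis. of_nat 2 * lin_fps i (z + 0 *\<^sub>R v) ^ (2 - 1) * (fps_const (i \<bullet> v) * (1 - fps_X)))"
    unfolding Basis_R3 by (simp, intro has_coeff_deriv_add)
      (use has_coeff_deriv_power[OF has_coeff_deriv_lin_fps, where k = 2] in simp_all)
  also have "(\<Sum>i\<in>Basis. of_nat 2 * lin_fps i (z + 0 *\<^sub>R v) ^ (2 - 1) * (fps_const (i \<bullet> v) * (1 - fps_X)))
     = 2 * (1 - fps_X) * lin_fps v z"
  proof -
    have "(\<Sum>i\<in>Basis. of_nat 2 * lin_fps i z ^ (2 - 1) * (fps_const (i \<bullet> v) * q)) =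
       2 * q * (\<Sum>i\<in>Basis. fps_const (i \<bullet> v) * lin_fps i z)" for q
      by (simp add: sum_distrib_left mult_ac)
    then show ?thesis by (simp flip: lin_fps_eq_sum_Basis)
  qed
  finally show ?thesis .
qed

text \<open>Differentiability has to be known before \<open>gen_fps_square\<close> can be
  differentiated implicitly; the resulting expression is irrelevant.\<close>

lemma has_coeff_deriv_gen_fps_ex:
  assumes "z \<in> half_space"
  obtains g' where "has_coeff_deriv (\<lambda>t. gen_fps (z + t *\<^sub>R v)) g'"
proof -
  obtain x1 x2 y where z: "z = (x1, x2, y)" by (cases z)
  obtain v1 v2 v3 where v: "v = (v1, v2, v3)" by (cases v)
  have D0: "pole_dist_sq (z + 0 *\<^sub>R v) > 0" using pole_dist_sq_pos[OF assms] by simp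
  then have D0': "(x1 + 0 * v1)\<^sup>2 + (x2 + 0 * v2)\<^sup>2 + (y + 0 * v3 + 1)\<^sup>2 \<noteq> 0"
    by (simp add: pole_dist_sq_def z v)
  have "(\<lambda>t. pole_dist_sq (z + t *\<^sub>R v)) differentiable at 0"
    unfolding pole_dist_sq_def z v by (auto intro!: derivative_intros)
  then obtain d where d: "((\<lambda>t. pole_dist_sq (z + t *\<^sub>R v)) has_real_derivative d) (at 0)"
    by (auto simp: real_differentiable_def)
  have "(\<lambda>t. legendre_lin_coeff (z + t *\<^sub>R v)) differentiable at 0" "(\<lambda>t. legendre_quad_coeff (z + t *\<^sub>R v)) differentiable at 0"
    unfolding pole_dist_sq_def legendre_lin_coeff_def legendre_quad_coeff_def z v
    using D0' by (auto intro!: derivative_intros)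
  then obtain a b where ab: "((\<lambda>t. legendre_lin_coeff (z + t *\<^sub>R v)) has_real_derivative a) (at 0)"
      "((\<lambda>t. legendre_quad_coeff (z + t *\<^sub>R v)) has_real_derivative b) (at 0)"
    by (auto simp: real_differentiable_def)
  have s: "((\<lambda>t. 1 / sqrt (pole_dist_sq (z + t *\<^sub>R v))) has_real_derivative
      - (d / (2 * sqrt (pole_dist_sq z))) / (sqrt (pole_dist_sq z))\<^sup>2) (at 0)"
    using D0 by (auto intro!: derivative_eq_intros d simp: power2_eq_square field_simps)
  have "((\<lambda>t. 2 * legendre_lin_coeff (z + t *\<^sub>R v)) has_real_derivative 2 * a) (at 0)"
    by (auto intro!: derivative_eq_intros ab)
  from has_coeff_deriv_diff[OF has_coeff_deriv_mult[OF has_coeff_deriv_fps_const[OF ab(2)] has_coeff_deriv_const]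
       has_coeff_deriv_mult[OF has_coeff_deriv_fps_const[OF this] has_coeff_deriv_const]]
  obtain w' where "has_coeff_deriv (\<lambda>t. fps_const (legendre_quad_coeff (z + t *\<^sub>R v)) * fps_X ^ 2 -
     fps_const (2 * legendre_lin_coeff (z + t *\<^sub>R v)) * fps_X) w'" by blast
  then obtain h' where "has_coeff_deriv (\<lambda>t. legendre_fps (legendre_lin_coeff (z + t *\<^sub>R v)) (legendre_quad_coeff (z + t *\<^sub>R v))) h'"
    unfolding legendre_fps_def by (rule has_coeff_deriv_compose)
  from has_coeff_deriv_mult[OF has_coeff_deriv_fps_const[OF s] this]
  show ?thesis using that unfolding gen_fps_def by blast
qed

text \<open>Implicit differentiation of S G^2 = 1, the formal counterpart of (W^(-1/2))' = -(1/2) W'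
  W^(-3/2).\<close>

lemma has_coeff_deriv_gen_fps:
  assumes "z \<in> half_space"
  shows "has_coeff_deriv (\<lambda>t. gen_fps (z + t *\<^sub>R v)) (- ((1 - fps_X) * lin_fps v z * gen_fps z ^ 3))"
proof -
  obtain g' where g': "has_coeff_deriv (\<lambda>t. gen_fps (z + t *\<^sub>R v)) g'"
    using has_coeff_deriv_gen_fps_ex[OF assms] .
  define S where "S = (\<Sum>i\<in>Basis. lin_fps i z ^ 2)"
  define q where "q = (1 - fps_X :: real fps)"
  define L where "L = lin_fps v z"
  define g where "g = gen_fps z"
  have "has_coeff_deriv (\<lambda>t. (\<Sum>i\<in>Basis. lin_fps i (z + t *\<^sub>R v) ^ 2) * gen_fps (z + t *\<^sub>R v) ^ 2)
     (2 * q * L * g ^ 2 + S * (2 * g * g'))"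
    using has_coeff_deriv_mult[OF has_coeff_deriv_sum_lin_fps_square[of z v] has_coeff_deriv_power[OF g', of 2]]
    by (simp add: S_def g_def q_def L_def)
  moreover have "has_coeff_deriv (\<lambda>t. (\<Sum>i\<in>Basis. lin_fps i (z + t *\<^sub>R v) ^ 2) * gen_fps (z + t *\<^sub>R v) ^ 2) 0"
  proof (rule has_coeff_deriv_cong[OF has_coeff_deriv_const[of 1]])
    show "eventually (\<lambda>t. 1 = (\<Sum>i\<in>Basis. lin_fps i (z + t *\<^sub>R v) ^ 2) * gen_fps (z + t *\<^sub>R v) ^ 2) (at 0)"
      using eventually_line_in_half_space[OF assms, of v] unfolding eventually_at_filter
      by eventually_elim (simp add: gen_fps_square)
  qed (use gen_fps_square[OF assms] in simp)
  ultimately have "2 * q * L * g ^ 2 + S * (2 * g * g') = 0"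
    by (rule has_coeff_deriv_unique)
  \<comment> \<open>Multiplying by g makes S g^2 = 1 appear, so that g' can be isolated without
    dividing by S.\<close>
  moreover have "(2 * q * L * g ^ 2 + S * (2 * g * g')) * g = 2 * (q * L * g ^ 3 + (S * g ^ 2) * g')"
    by (simp add: algebra_simps power2_eq_square power3_eq_cube)
  moreover have "S * g ^ 2 = 1" unfolding S_def g_def by (rule gen_fps_square[OF assms])
  ultimately have "fps_const 2 * (q * L * g ^ 3 + g') = 0"
    by (simp only: mult_zero_left mult_1 numeral_fps_const)
  then have "q * L * g ^ 3 + g' = 0" by (simp only: mult_eq_0_iff fps_const_eq_0_iff) simp
  then have "g' = - (q * L * g ^ 3)" by (simp add: eq_neg_iff_add_eq_0 add.commute)
  with g' show ?thesis by (simp add: q_def L_def g_def)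
qed

definition gen_deriv_fps :: "R3 \<Rightarrow> R3 \<Rightarrow> real fps" where
  "gen_deriv_fps v z = - ((1 - fps_X) * lin_fps v z * gen_fps z ^ 3)"

definition gen_deriv2_fps :: "R3 \<Rightarrow> R3 \<Rightarrow> R3 \<Rightarrow> real fps" where
  "gen_deriv2_fps w v z = (1 - fps_X) ^ 2 *
     (3 * lin_fps w z * lin_fps v z * gen_fps z ^ 5 - fps_const (w \<bullet> v) * gen_fps z ^ 3)"

lemma has_coeff_deriv_gen_deriv_fps:
  assumes "z \<in> half_space"
  shows "has_coeff_deriv (\<lambda>t. gen_deriv_fps w (z + t *\<^sub>R v)) (gen_deriv2_fps w v z)"
proof -
  define q where "q = (1 - fps_X :: real fps)"
  define L where "L = lin_fps v z"
  define M where "M = lin_fps w z"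
  define g where "g = gen_fps z"
  define c where "c = fps_const (w \<bullet> v)"
  have "gen_deriv2_fps w v z = - ((q * (c * q)) * g ^ 3 + q * M * (of_nat 3 * g ^ (3 - 1) * (- (q * L * g ^ 3))))"
    unfolding gen_deriv2_fps_def q_def[symmetric] L_def[symmetric] M_def[symmetric] g_def[symmetric] c_def[symmetric]
    by (simp add: algebra_simps eval_nat_numeral)
  with has_coeff_deriv_minus[OF has_coeff_deriv_mult[OF has_coeff_deriv_mult[OF has_coeff_deriv_const[of q]
      has_coeff_deriv_lin_fps[of w z v]] has_coeff_deriv_power[OF has_coeff_deriv_gen_fps[OF assms, of v], of 3]]]
  show ?thesis
    by (simp add: q_def L_def M_def g_def c_def gen_deriv_fps_def)
qed

text \<open>The inner products of the basis vectors with themselves add up to the dimension 3, which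
  matches the 3 from differentiating G^3; since W G^2 = 1, the two terms cancel. This is the
  harmonicity of 1 / |z| in three dimensions.\<close>

lemma sum_gen_deriv2_fps_Basis:
  assumes "z \<in> half_space"
  shows "(\<Sum>i\<in>Basis. gen_deriv2_fps i i z) = 0"
proof -
  define g where "g = gen_fps z"
  have "(\<Sum>i\<in>Basis. gen_deriv2_fps i i z) =
     (1 - fps_X) ^ 2 * (3 * ((\<Sum>i\<in>Basis. lin_fps i z ^ 2) * g ^ 2) * g ^ 3 - 3 * g ^ 3)"
    unfolding gen_deriv2_fps_def g_def[symmetric]
    by (simp add: Basis_R3 algebra_simps eval_nat_numeral)
  also have "(\<Sum>i\<in>Basis. lin_fps i z ^ 2) * g ^ 2 = 1"
    unfolding g_def by (rule gen_fps_square[OF assms])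
  finally show ?thesis by simp
qed

section \<open>Continuity of the coefficients and transfer to u_n\<close>

lemma continuous_on_pole_dist_sq [continuous_intros]: "continuous_on S pole_dist_sq"
  unfolding pole_dist_sq_def case_prod_beta by (intro continuous_intros)

lemma coeffwise_continuous_on_gen_fps: "coeffwise_continuous_on half_space gen_fps"
proof -
  have "pole_dist_sq z \<noteq> 0" if "z \<in> half_space" for z using pole_dist_sq_pos[OF that] by simp
  then show ?thesis
    unfolding gen_fps_def legendre_fps_def legendre_lin_coeff_def legendre_quad_coeff_def case_prod_beta
    by (intro coeffwise_continuous_intros continuous_intros) auto
qed

lemma coeffwise_continuous_on_lin_fps: "coeffwise_continuous_on S (lin_fps v)"
  unfolding lin_fps_def by (intro coeffwise_continuous_intros continuous_intros)

lemma coeffwise_continuous_on_gen_deriv_fps: "coeffwise_continuous_on half_space (gen_deriv_fps v)"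
proof -
  have "gen_deriv_fps v = (\<lambda>z. (- 1) * (1 - fps_X) * lin_fps v z * gen_fps z ^ 3)"
    by (auto simp: gen_deriv_fps_def algebra_simps)
  then show ?thesis
    using coeffwise_continuous_on_gen_fps coeffwise_continuous_on_lin_fps[of _ v]
    by (auto intro!: coeffwise_continuous_intros)
qed

lemma coeffwise_continuous_on_gen_deriv2_fps: "coeffwise_continuous_on half_space (gen_deriv2_fps w v)"
  unfolding gen_deriv2_fps_def
  using coeffwise_continuous_on_gen_fps coeffwise_continuous_on_lin_fps[of _ v]
    coeffwise_continuous_on_lin_fps[of _ w]
  by (auto intro!: coeffwise_continuous_intros)

text \<open>Used twice: with F = \<open>gen_fps\<close> for u_n itself, then with F =
  \<open>gen_deriv_fps w\<close> for its first derivatives. Together this gives C2 and the second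
  derivatives.\<close>

lemma C1_on_coeff:
  fixes f :: "R3 \<Rightarrow> complex"
  assumes f: "\<And>z. z \<in> half_space \<Longrightarrow> f z = complex_of_real (\<kappa> * fps_nth (F z) n)"
    and F': "\<And>v z. z \<in> half_space \<Longrightarrow> has_coeff_deriv (\<lambda>t. F (z + t *\<^sub>R v)) (F' v z)"
    and contF: "coeffwise_continuous_on half_space F"
    and contF': "\<And>v. coeffwise_continuous_on half_space (F' v)"
  shows "C1_on half_space f"
    and "z \<in> half_space \<Longrightarrow> dir_deriv v f z = complex_of_real (\<kappa> * fps_nth (F' v z) n)"
proof -
  have vd: "((\<lambda>t. f (z + t *\<^sub>R v)) has_vector_derivative complex_of_real (\<kappa> * fps_nth (F' v z) n)) (at 0)"
    if z: "z \<in> half_space" for v z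
  proof -
    have "((\<lambda>t. \<kappa> * fps_nth (F (z + t *\<^sub>R v)) n) has_real_derivative \<kappa> * fps_nth (F' v z) n) (at 0)"
      using F'[OF z, of v] unfolding has_coeff_deriv_def by (intro DERIV_cmult) auto
    then have "((\<lambda>t. complex_of_real (\<kappa> * fps_nth (F (z + t *\<^sub>R v)) n)) has_vector_derivative
        complex_of_real (\<kappa> * fps_nth (F' v z) n)) (at 0)"
      by (intro has_vector_derivative_of_real) (simp add: has_real_derivative_iff_has_vector_derivative)
    moreover have "eventually (\<lambda>t. complex_of_real (\<kappa> * fps_nth (F (z + t *\<^sub>R v)) n) = f (z + t *\<^sub>R v)) (nhds 0)"
      using eventually_line_in_half_space[OF z, of v] by eventually_elim (simp add: f)
    ultimately show ?thesis
      by (subst has_vector_derivative_cong_ev[symmetric]) (auto dest: eventually_nhds_x_imp_x elim: eventually_mono)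
  qed
  then have dd: "dir_deriv v f z = complex_of_real (\<kappa> * fps_nth (F' v z) n)" if "z \<in> half_space" for v z
    using that unfolding dir_deriv_def by (intro vector_derivative_at) auto
  then show "z \<in> half_space \<Longrightarrow> dir_deriv v f z = complex_of_real (\<kappa> * fps_nth (F' v z) n)" .
  have "continuous_on half_space f"
    using contF by (subst continuous_on_cong[OF refl f])
      (auto simp: coeffwise_continuous_on_def simp del: of_real_mult intro!: continuous_intros)
  moreover have "continuous_on half_space (dir_deriv v f)" for v
    using contF'[of v] by (subst continuous_on_cong[OF refl dd])
      (auto simp: coeffwise_continuous_on_def simp del: of_real_mult intro!: continuous_intros)
  moreover have "(\<lambda>t. f (z + t *\<^sub>R v)) differentiable (at 0)" if "z \<in> half_space" for v z
    using vd[OF that] by (rule differentiableI_vector)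
  ultimately show "C1_on half_space f" by (auto simp: C1_on_def)
qed

text \<open>With N and D the squared distances to (0, 0, 1) and (0, 0, -1), a = sqrt (N / D) and b =
  (\<rho>^2 - 1) / sqrt (N D), so sqrt N cancels in a b. The cancellation needs N \<noteq> 0, which
  is why the point (0, 0, 1) is excluded.\<close>

lemma u_formula_eq_gen_fps_nth:
  assumes "z \<in> half_space" "z \<noteq> (0, 0, 1)"
  shows "u_formula n z = sqrt (2 / pi) * fps_nth (gen_fps z) n"
proof -
  obtain x1 x2 y where z: "z = (x1, x2, y)" by (cases z)
  have rho: "(rho z)\<^sup>2 = x1\<^sup>2 + x2\<^sup>2 + y\<^sup>2" by (simp add: rho_def z)
  define N where "N = x1\<^sup>2 + x2\<^sup>2 + (y - 1)\<^sup>2"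
  define D where "D = pole_dist_sq z"
  have "N \<noteq> 0" using assms(2) unfolding N_def z by (auto simp: add_nonneg_eq_0_iff)
  moreover have "N \<ge> 0" by (simp add: N_def)
  ultimately have N: "N > 0" by simp
  have D: "D > 0" using pole_dist_sq_pos[OF assms(1)] by (simp add: D_def)
  have Deq: "(rho z)\<^sup>2 + 2 * y + 1 = D" and Neq: "(rho z)\<^sup>2 - 2 * y + 1 = N"
    unfolding rho by (simp_all add: D_def pole_dist_sq_def N_def z power2_eq_square algebra_simps)
  have ND: "((rho z)\<^sup>2 + 1)\<^sup>2 - 4 * y\<^sup>2 = N * D"
    unfolding Deq[symmetric] Neq[symmetric] by (simp add: power2_eq_square algebra_simps)
  have a: "a_fun z = sqrt (N / D)"
    unfolding a_fun_def z by (simp add: Deq[unfolded z] Neq[unfolded z])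
  have b: "b_fun z = ((rho z)\<^sup>2 - 1) / sqrt (N * D)"
    unfolding b_fun_def z by (simp add: ND[unfolded z])
  have "(a_fun z)\<^sup>2 = legendre_quad_coeff z"
  proof -
    have "(a_fun z)\<^sup>2 = N / D" using N D unfolding a by simp
    then show ?thesis by (simp add: legendre_quad_coeff_def z N_def D_def)
  qed
  moreover have "a_fun z * b_fun z = legendre_lin_coeff z"
  proof -
    have "sqrt D * sqrt D = D" using D by simp
    then have "a_fun z * b_fun z = ((rho z)\<^sup>2 - 1) / D"
      unfolding a b real_sqrt_divide real_sqrt_mult using N D by (simp add: divide_simps)
    then show ?thesis unfolding rho by (simp add: legendre_lin_coeff_def D_def z)
  qed
  ultimately show ?thesis
    using legendre_fps_nth_eq[of "a_fun z" "b_fun z" n]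
    by (simp add: u_formula_def z gen_fps_def Deq[unfolded z] D_def)
qed

text \<open>At (0, 0, 1) the coefficient is continuous and agrees with the formula at all other
  nearby points, so its value is the limit that defines u_n there.\<close>

lemma u_eq_gen_fps_nth:
  assumes "z \<in> half_space"
  shows "u n z = complex_of_real (sqrt (2 / pi) * fps_nth (gen_fps z) n)"
proof (cases "z = (0, 0, 1)")
  case False
  then show ?thesis using u_formula_eq_gen_fps_nth[OF assms] by (simp add: u_def)
next
  case True
  have "continuous_on half_space (\<lambda>z. sqrt (2 / pi) * fps_nth (gen_fps z) n)"
    using coeffwise_continuous_on_gen_fps
    by (auto simp: coeffwise_continuous_on_def intro!: continuous_intros)
  then have "((\<lambda>z. sqrt (2 / pi) * fps_nth (gen_fps z) n) \<longlongrightarrow> sqrt (2 / pi) * fps_nth (gen_fps z) n) (at z)"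
    using assms open_half_space by (simp add: continuous_on_eq_continuous_at isCont_def)
  moreover have "eventually (\<lambda>w. w \<in> half_space \<and> w \<noteq> z) (at z)"
    using eventually_nhds_in_open[OF open_half_space assms] by (auto simp: eventually_at_filter elim: eventually_mono)
  then have "eventually (\<lambda>w. sqrt (2 / pi) * fps_nth (gen_fps w) n = u_formula n w) (at z)"
    by eventually_elim (use True in \<open>simp add: u_formula_eq_gen_fps_nth\<close>)
  ultimately have "(u_formula n \<longlongrightarrow> sqrt (2 / pi) * fps_nth (gen_fps z) n) (at z)"
    by (rule Lim_transform_eventually)
  then have "Lim (at z) (u_formula n) = sqrt (2 / pi) * fps_nth (gen_fps z) n"
    by (intro tendsto_Lim) auto
  then show ?thesis using True by (simp add: u_def)
qed

lemma C1_on_u: "C1_on half_space (u n)"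
  and dir_deriv_u: "z \<in> half_space \<Longrightarrow>
    dir_deriv v (u n) z = complex_of_real (sqrt (2 / pi) * fps_nth (gen_deriv_fps v z) n)"
  using C1_on_coeff[OF u_eq_gen_fps_nth has_coeff_deriv_gen_fps[folded gen_deriv_fps_def]
      coeffwise_continuous_on_gen_fps coeffwise_continuous_on_gen_deriv_fps] by blast+

lemma C1_on_dir_deriv_u: "C1_on half_space (dir_deriv w (u n))"
  and dir_deriv2_u: "z \<in> half_space \<Longrightarrow> dir_deriv v (dir_deriv w (u n)) z =
    complex_of_real (sqrt (2 / pi) * fps_nth (gen_deriv2_fps w v z) n)"
  using C1_on_coeff[OF dir_deriv_u has_coeff_deriv_gen_deriv_fps
      coeffwise_continuous_on_gen_deriv_fps coeffwise_continuous_on_gen_deriv2_fps] by blast+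

lemma harmonic_on_u: "harmonic_on half_space (u n)"
proof -
  have "laplacian (u n) z = 0" if "z \<in> half_space" for z
  proof -
    have "laplacian (u n) z =
        complex_of_real (sqrt (2 / pi) * fps_nth (\<Sum>i\<in>Basis. gen_deriv2_fps i i z) n)"
      unfolding laplacian_def dir_deriv2_u[OF that] by (simp add: fps_sum_nth sum_distrib_left)
    then show ?thesis by (simp add: sum_gen_deriv2_fps_Basis[OF that])
  qed
  then show ?thesis
    by (auto simp: harmonic_on_def C2_on_def open_half_space C1_on_u C1_on_dir_deriv_u)
qed

subsection \<open>Integrals over the half-space\<close>

text \<open>Polar coordinates in the variable v = r^2: a disc of squared radius v has area pi v, so
  the image measure has constant density. It suffices to compare the two measures on
  half-lines.\<close>

lemma distr_norm_square_lborel_2d: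
  "distr lborel borel (\<lambda>x::real \<times> real. (norm x)\<^sup>2) =
     density lborel (\<lambda>v. ennreal pi * indicator {0..} v)" (is "?M = ?N")
proof (rule measure_eqI_generator_eq)
  let ?E = "range (\<lambda>a::real. {..a})"
  show "Int_stable ?E"
    by (auto simp: Int_stable_def)
  show "?E \<subseteq> Pow UNIV" by simp
  have em: "emeasure ?M {..a} = ennreal (pi * max 0 a)" for a :: real
  proof -
    have "emeasure ?M {..a} = emeasure lborel ((\<lambda>x::real \<times> real. (norm x)\<^sup>2) -` {..a})"
      by (subst emeasure_distr) auto
    also have "(\<lambda>x::real \<times> real. (norm x)\<^sup>2) -` {..a} = (if a < 0 then {} else cball 0 (sqrt a))"
    proof (cases "a < 0")
      case True
      have "\<not> (norm x)\<^sup>2 \<le> a" for x :: "real \<times> real"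
        using True zero_le_power2[of "norm x"] by linarith
      then show ?thesis using True by auto
    next
      case False
      then show ?thesis
        using abs_le_square_iff[of "norm x" "sqrt a" for x :: "real \<times> real"]
        by (simp add: set_eq_iff)
    qed
    also have "emeasure lborel \<dots> = ennreal (pi * max 0 a)"
    proof (cases "a < 0")
      case False
      then have "emeasure lborel (cball (0 :: real \<times> real) (sqrt a)) = ennreal (unit_ball_vol 2 * sqrt a ^ 2)"
        using emeasure_cball[of "sqrt a" "0 :: real \<times> real"] by (simp add: eval_nat_numeral)
      with False show ?thesis by (simp add: unit_ball_vol_2)
    qed auto
    finally show ?thesis .
  qed
  have en: "emeasure ?N {..a} = ennreal (pi * max 0 a)" for a :: real
  proof -
    have "emeasure ?N {..a} = (\<integral>\<^sup>+v. ennreal pi * indicator {0..a} v \<partial>lborel)"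
      by (subst emeasure_density) (auto intro!: nn_integral_cong split: split_indicator)
    also have "\<dots> = ennreal pi * emeasure lborel {0..a}"
      by (simp add: nn_integral_cmult)
    also have "emeasure lborel {0..a} = ennreal (max 0 a)"
      by (cases "0 \<le> a") auto
    finally show ?thesis by (simp add: ennreal_mult')
  qed
  show "emeasure ?M X = emeasure ?N X" if "X \<in> ?E" for X
    using that em en by auto
  show "sets ?M = sigma_sets UNIV ?E" "sets ?N = sigma_sets UNIV ?E"
    by (simp_all add: borel_eq_atMost)
  show "range (\<lambda>n::nat. {..real n}) \<subseteq> ?E" by auto
  show "(\<Union>n::nat. {..real n}) = UNIV" using real_arch_simple by auto
  show "emeasure ?M {..real n} \<noteq> \<infinity>" for n :: nat
    by (simp add: em)
qed

lemma nn_integral_radial_2d: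
  fixes f :: "real \<Rightarrow> ennreal"
  assumes [measurable]: "f \<in> borel_measurable borel"
  shows "(\<integral>\<^sup>+x. f ((norm x)\<^sup>2) \<partial>(lborel :: (real \<times> real) measure)) =
         ennreal pi * (\<integral>\<^sup>+v. f v * indicator {0..} v \<partial>lborel)"
proof -
  have "(\<integral>\<^sup>+x. f ((norm x)\<^sup>2) \<partial>(lborel :: (real \<times> real) measure)) =
        (\<integral>\<^sup>+v. f v \<partial>distr lborel borel (\<lambda>x::real \<times> real. (norm x)\<^sup>2))"
    by (subst nn_integral_distr) auto
  also have "\<dots> = (\<integral>\<^sup>+v. ennreal pi * (f v * indicator {0..} v) \<partial>lborel)"
    unfolding distr_norm_square_lborel_2d
    by (subst nn_integral_density) (auto intro!: nn_integral_cong simp: mult_ac)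
  finally show ?thesis by (simp add: nn_integral_cmult)
qed

text \<open>In the nested triple y is the innermost variable. Two exchanges of integrals move it
  outermost and bring x1 and x2 together, as the radial formula requires.\<close>

lemma nn_integral_half_space_radial:
  fixes f :: "real \<Rightarrow> real \<Rightarrow> ennreal"
  assumes [measurable]: "case_prod f \<in> borel_measurable borel"
  shows "(\<integral>\<^sup>+(x1, x2, y). f (x1\<^sup>2 + x2\<^sup>2) y * indicator {0<..} y \<partial>lborel) =
         (\<integral>\<^sup>+y. (ennreal pi * (\<integral>\<^sup>+v. f v y * indicator {0..} v \<partial>lborel)) * indicator {0<..} y \<partial>lborel)"
proof -
  have [measurable]: "(\<lambda>x. f (g x) (h x)) \<in> borel_measurable M"
    if "g \<in> borel_measurable M" "h \<in> borel_measurable M" for g h and M :: "'c measure"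
    using measurable_compose[OF borel_measurable_Pair[OF that] assms] by simp
  have "(\<integral>\<^sup>+(x1, x2, y). f (x1\<^sup>2 + x2\<^sup>2) y * indicator {0<..} y \<partial>lborel) =
    (\<integral>\<^sup>+x1. (\<integral>\<^sup>+x2. \<integral>\<^sup>+y. f (x1\<^sup>2 + x2\<^sup>2) y * indicator {0<..} y \<partial>lborel \<partial>lborel) \<partial>lborel)"
    unfolding lborel_prod[symmetric]
    by (subst lborel_pair.nn_integral_fst[symmetric] | subst lborel.nn_integral_fst[symmetric] | simp add: case_prod_beta)+
  also have "\<dots> = (\<integral>\<^sup>+x1. (\<integral>\<^sup>+y. \<integral>\<^sup>+x2. f (x1\<^sup>2 + x2\<^sup>2) y * indicator {0<..} y \<partial>lborel \<partial>lborel) \<partial>lborel)"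
    by (intro nn_integral_cong lborel_pair.Fubini') simp
  also have "\<dots> = (\<integral>\<^sup>+y. (\<integral>\<^sup>+x1. \<integral>\<^sup>+x2. f (x1\<^sup>2 + x2\<^sup>2) y * indicator {0<..} y \<partial>lborel \<partial>lborel) \<partial>lborel)"
    by (intro lborel_pair.Fubini') simp
  also have "\<dots> = (\<integral>\<^sup>+y. (ennreal pi * (\<integral>\<^sup>+v. f v y * indicator {0..} v \<partial>lborel)) * indicator {0<..} y \<partial>lborel)"
  proof (rule nn_integral_cong)
    fix y :: real
    have "(\<integral>\<^sup>+x1. \<integral>\<^sup>+x2. f (x1\<^sup>2 + x2\<^sup>2) y * indicator {0<..} y \<partial>lborel \<partial>lborel) =
      (\<integral>\<^sup>+x. f ((norm x)\<^sup>2) y * indicator {0<..} y \<partial>(lborel :: (real \<times> real) measure))"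
      unfolding lborel_prod[symmetric]
      by (subst lborel.nn_integral_fst[symmetric]) (simp_all add: norm_prod_def)
    also have "\<dots> = (\<integral>\<^sup>+x. f ((norm x)\<^sup>2) y \<partial>(lborel :: (real \<times> real) measure)) * indicator {0<..} y"
      by (simp add: nn_integral_multc)
    also have "\<dots> = (ennreal pi * (\<integral>\<^sup>+v. f v y * indicator {0..} v \<partial>lborel)) * indicator {0<..} y"
      by (subst nn_integral_radial_2d[of "\<lambda>v. f v y"]) simp_all
    finally show "(\<integral>\<^sup>+x1. \<integral>\<^sup>+x2. f (x1\<^sup>2 + x2\<^sup>2) y * indicator {0<..} y \<partial>lborel \<partial>lborel) = \<dots>" .
  qed
  finally show ?thesis .
qed

lemma nn_integral_Ioi_eq_Ici:
  fixes f :: "real \<Rightarrow> ennreal"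
  shows "(\<integral>\<^sup>+x. f x * indicator {a<..} x \<partial>lborel) = (\<integral>\<^sup>+x. f x * indicator {a..} x \<partial>lborel)"
proof (rule nn_integral_cong_AE)
  show "AE x in lborel. f x * indicator {a<..} x = f x * indicator {a..} x"
    using AE_lborel_singleton[of a] by eventually_elim (simp add: indicator_def)
qed

section \<open>Closed forms of the integrals\<close>

lemma nn_integral_inverse_square:
  fixes a b :: real
  assumes "a > 0" "b \<ge> 0"
  shows "(\<integral>\<^sup>+x. ennreal (b / (a * x + 1)\<^sup>2) * indicator {0..} x \<partial>lborel) = ennreal (b / a)"
proof -
  have "(\<integral>\<^sup>+x. ennreal (b / (a * x + 1)\<^sup>2) * indicator {0..} x \<partial>lborel) =
      ennreal (0 - (- b / a / (a * 0 + 1)))"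
  proof (rule nn_integral_FTC_atLeast)
    show "((\<lambda>x. - b / a / (a * x + 1)) has_real_derivative b / (a * x + 1)\<^sup>2) (at x)" if "0 \<le> x" for x
      using assms that by (auto intro!: derivative_eq_intros simp: power2_eq_square add_nonneg_eq_0_iff)
    show "((\<lambda>x. - b / a / (a * x + 1)) \<longlongrightarrow> 0) at_top"
      using assms by real_asymp
  qed (use assms in auto)
  then show ?thesis by simp
qed

lemma nn_integral_inverse_affine_square:
  fixes a b h :: real
  assumes "a > 0" "b \<ge> 0" "h > 0"
  shows "(\<integral>\<^sup>+x. ennreal (b / (a * x + h)\<^sup>2) * indicator {0..} x \<partial>lborel) = ennreal (b / (a * h))"
proof -
  have *: "b / (a * x + h)\<^sup>2 = (b / h\<^sup>2) / ((a / h) * x + 1)\<^sup>2" for x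
  proof -
    have "a * x + h = h * ((a / h) * x + 1)" using assms by (simp add: field_simps)
    then show ?thesis by (simp only: power_mult_distrib divide_divide_eq_left)
  qed
  show ?thesis unfolding *
    using nn_integral_inverse_square[of "a / h" "b / h\<^sup>2"] assms
    by (simp add: power2_eq_square mult.commute[of h a])
qed

text \<open>The semigroup law of the Poisson kernels of the plane, evaluated at the origin: after
  multiplication by pi p q the left side is, up to (2 pi)^2, the convolution of the kernels at
  heights p and q, and the right side is the kernel at height p + q.\<close>

lemma nn_integral_inverse_cubes:
  fixes p q :: real
  assumes "p > 0" "q > 0"
  shows "(\<integral>\<^sup>+v. ennreal (1 / (sqrt (v + p\<^sup>2) ^ 3 * sqrt (v + q\<^sup>2) ^ 3)) * indicator {0..} v \<partial>lborel) =
           ennreal (2 / (p * q * (p + q)\<^sup>2))"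
proof -
  define X where "X v = sqrt (v + p\<^sup>2)" for v
  define Y where "Y v = sqrt (v + q\<^sup>2)" for v
  \<comment> \<open>Guessed from the claim: the tail integral from \<open>v\<close> is the claim with \<open>p, q\<close> replaced by \<open>X v, Y v\<close>.\<close>
  define F where "F v = - 2 / (X v * Y v * (X v + Y v)\<^sup>2)" for v
  have "(\<integral>\<^sup>+v. ennreal (1 / (X v ^ 3 * Y v ^ 3)) * indicator {0..} v \<partial>lborel) = ennreal (0 - F 0)"
  proof (rule nn_integral_FTC_atLeast)
    fix v :: real assume "0 \<le> v"
    then have pos: "X v > 0" "Y v > 0" using assms by (auto simp: X_def Y_def intro: add_nonneg_pos)
    have dX: "(X has_real_derivative 1 / (2 * X v)) (at v)"
      unfolding X_def using pos(1) by (auto simp: X_def intro!: derivative_eq_intros simp: field_simps)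
    have dY: "(Y has_real_derivative 1 / (2 * Y v)) (at v)"
      unfolding Y_def using pos(2) by (auto simp: Y_def intro!: derivative_eq_intros simp: field_simps)
    define x y where "x = X v" and "y = Y v"
    have xy: "x > 0" "y > 0" using pos by (auto simp: x_def y_def)
    \<comment> \<open>Since x' = 1 / (2 x) and y' = 1 / (2 y), the product rule yields (x + y)^2
      ((x^2 + y^2) / (2 x y) + 1), which collapses to a fourth power. It cancels against the squared
      denominator in the derivative of F.\<close>
    have dP: "((\<lambda>v. X v * Y v * (X v + Y v)\<^sup>2) has_real_derivative (x + y) ^ 4 / (2 * x * y)) (at v)"
    proof (rule DERIV_cong[OF DERIV_mult[OF DERIV_mult[OF dX dY] DERIV_power[OF DERIV_add[OF dX dY], where n = 2]]])
      show "(1 / (2 * X v) * Y v + 1 / (2 * Y v) * X v) * (X v + Y v)\<^sup>2 +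
         of_nat 2 * ((1 / (2 * X v) + 1 / (2 * Y v)) * (X v + Y v) ^ (2 - Suc 0)) * (X v * Y v) =
         (x + y) ^ 4 / (2 * x * y)"
        unfolding x_def[symmetric] y_def[symmetric] using xy
        by (simp add: divide_simps) (simp add: power2_eq_square power4_eq_xxxx algebra_simps)
    qed
    define s where "s = x + y"
    have "s > 0" using xy by (simp add: s_def)
    have "(F has_real_derivative 1 / (X v ^ 3 * Y v ^ 3)) (at v)"
      unfolding F_def
    proof (rule DERIV_cong[OF DERIV_divide[OF DERIV_const dP]])
      show "X v * Y v * (X v + Y v)\<^sup>2 \<noteq> 0" using pos by simp
      show "(0 * (X v * Y v * (X v + Y v)\<^sup>2) - - 2 * ((x + y) ^ 4 / (2 * x * y))) /
          (X v * Y v * (X v + Y v)\<^sup>2 * (X v * Y v * (X v + Y v)\<^sup>2)) = 1 / (X v ^ 3 * Y v ^ 3)"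
        unfolding x_def[symmetric] y_def[symmetric] s_def[symmetric] using xy \<open>s > 0\<close>
        by (simp add: divide_simps power2_eq_square power4_eq_xxxx power3_eq_cube)
    qed
    then show "(F has_real_derivative 1 / (X v ^ 3 * Y v ^ 3)) (at v)" .
    show "0 \<le> 1 / (X v ^ 3 * Y v ^ 3)" using pos by simp
  next
    show "(F \<longlongrightarrow> 0) at_top"
    proof -
      have shift: "filterlim (\<lambda>v. sqrt (v + c)) at_top at_top" for c :: real
        using filterlim_compose[OF sqrt_at_top filterlim_tendsto_add_at_top[OF tendsto_const[of c] filterlim_ident]]
        by (simp add: add.commute)
      have "filterlim (\<lambda>v. X v * Y v * (X v + Y v)\<^sup>2) at_top at_top"
        unfolding X_def Y_def
        by (intro filterlim_at_top_mult_at_top filterlim_pow_at_top filterlim_at_top_add_at_top shift) simp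
      then show ?thesis
        unfolding F_def by (intro tendsto_divide_0[OF tendsto_const] filterlim_at_top_imp_at_infinity)
    qed
  qed (simp add: X_def Y_def)
  then show ?thesis using assms by (simp add: F_def X_def Y_def)
qed

text \<open>The integrand is the dominating function for all products of y-derivatives below, each
  factor being bounded by a multiple of 1 / \<open>pole_dist_sq\<close>.\<close>

lemma nn_integral_half_space_inverse_pole_dist4:
  "(\<integral>\<^sup>+(x1, x2, y). ennreal (1 / (x1\<^sup>2 + x2\<^sup>2 + (y + 1)\<^sup>2)\<^sup>2) * indicator {0<..} y \<partial>lborel) = ennreal pi"
proof -
  have "(\<integral>\<^sup>+(x1, x2, y). ennreal (1 / (x1\<^sup>2 + x2\<^sup>2 + (y + 1)\<^sup>2)\<^sup>2) * indicator {0<..} y \<partial>lborel) =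
    (\<integral>\<^sup>+y. (ennreal pi * (\<integral>\<^sup>+v. ennreal (1 / (v + (y + 1)\<^sup>2)\<^sup>2) * indicator {0..} v \<partial>lborel)) * indicator {0<..} y \<partial>lborel)"
    by (rule nn_integral_half_space_radial) (simp add: borel_prod[symmetric])
  also have "\<dots> = (\<integral>\<^sup>+y. ennreal (pi / (1 * y + 1)\<^sup>2) * indicator {0<..} y \<partial>lborel)"
  proof (rule nn_integral_cong)
    fix y :: real
    show "(ennreal pi * (\<integral>\<^sup>+v. ennreal (1 / (v + (y + 1)\<^sup>2)\<^sup>2) * indicator {0..} v \<partial>lborel)) * indicator {0<..} y
      = ennreal (pi / (1 * y + 1)\<^sup>2) * indicator {0<..} y"
      using nn_integral_inverse_affine_square[of 1 1 "(y + 1)\<^sup>2"]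
      by (auto simp: ennreal_mult[symmetric] split: split_indicator)
  qed
  also have "\<dots> = ennreal pi"
    unfolding nn_integral_Ioi_eq_Ici by (subst nn_integral_inverse_affine_square) auto
  finally show ?thesis .
qed

text \<open>At fixed y the plane integral is 2 pi / (2 y + c + d)^2 by the previous computation with
  p = y + c and q = y + d; integrating over y > 0 leaves pi / (c + d).\<close>

lemma nn_integral_half_space_Poisson_kernels:
  assumes "c > 0" "d > 0"
  shows "(\<integral>\<^sup>+(x1, x2, y). ennreal ((y + c) / sqrt (x1\<^sup>2 + x2\<^sup>2 + (y + c)\<^sup>2) ^ 3 *
             ((y + d) / sqrt (x1\<^sup>2 + x2\<^sup>2 + (y + d)\<^sup>2) ^ 3)) * indicator {0<..} y \<partial>lborel) =
         ennreal (pi / (c + d))"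
proof -
  have "(\<integral>\<^sup>+(x1, x2, y). ennreal ((y + c) / sqrt (x1\<^sup>2 + x2\<^sup>2 + (y + c)\<^sup>2) ^ 3 *
             ((y + d) / sqrt (x1\<^sup>2 + x2\<^sup>2 + (y + d)\<^sup>2) ^ 3)) * indicator {0<..} y \<partial>lborel) =
    (\<integral>\<^sup>+y. (ennreal pi * (\<integral>\<^sup>+v. ennreal ((y + c) / sqrt (v + (y + c)\<^sup>2) ^ 3 *
             ((y + d) / sqrt (v + (y + d)\<^sup>2) ^ 3)) * indicator {0..} v \<partial>lborel)) * indicator {0<..} y \<partial>lborel)"
    by (rule nn_integral_half_space_radial) (simp add: borel_prod[symmetric])
  also have "\<dots> = (\<integral>\<^sup>+y. ennreal (2 * pi / (2 * y + (c + d))\<^sup>2) * indicator {0<..} y \<partial>lborel)"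
  proof (rule nn_integral_cong)
    fix y :: real
    show "(ennreal pi * (\<integral>\<^sup>+v. ennreal ((y + c) / sqrt (v + (y + c)\<^sup>2) ^ 3 *
             ((y + d) / sqrt (v + (y + d)\<^sup>2) ^ 3)) * indicator {0..} v \<partial>lborel)) * indicator {0<..} y
      = ennreal (2 * pi / (2 * y + (c + d))\<^sup>2) * indicator {0<..} y"
    proof (cases "y > 0")
      case True
      then have pos: "y + c > 0" "y + d > 0" using assms by auto
      have "(\<integral>\<^sup>+v. ennreal ((y + c) / sqrt (v + (y + c)\<^sup>2) ^ 3 *
             ((y + d) / sqrt (v + (y + d)\<^sup>2) ^ 3)) * indicator {0..} v \<partial>lborel) =
          (\<integral>\<^sup>+v. ennreal ((y + c) * (y + d)) * (ennreal (1 / (sqrt (v + (y + c)\<^sup>2) ^ 3 *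
             sqrt (v + (y + d)\<^sup>2) ^ 3)) * indicator {0..} v) \<partial>lborel)"
        using pos by (intro nn_integral_cong)
          (auto simp: ennreal_mult[symmetric] split: split_indicator)
      also have "\<dots> = ennreal ((y + c) * (y + d)) * ennreal (2 / ((y + c) * (y + d) * (y + c + (y + d))\<^sup>2))"
        using pos by (subst nn_integral_cmult) (simp_all add: nn_integral_inverse_cubes)
      also have "\<dots> = ennreal (2 / (2 * y + (c + d))\<^sup>2)"
        using pos by (subst ennreal_mult[symmetric]) (simp_all add: add_ac)
      finally show ?thesis
        using True by (simp add: ennreal_mult[symmetric] mult_ac)
    qed auto
  qed
  also have "\<dots> = ennreal (2 * pi / (2 * (c + d)))"
    unfolding nn_integral_Ioi_eq_Ici using assms by (subst nn_integral_inverse_affine_square) auto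
  also have "2 * pi / (2 * (c + d)) = pi / (c + d)"
    by (rule mult_divide_mult_cancel_left) simp
  finally show ?thesis .
qed

subsection \<open>Orthonormality\<close>

text \<open>In the applications c carries all dependence on the point z, while the ratio M is the
  same for all z; this gives one range of s for the whole half-space.\<close>

definition geom_bounded :: "real \<Rightarrow> real \<Rightarrow> real fps \<Rightarrow> bool" where
  "geom_bounded c M f \<longleftrightarrow> (\<forall>n. \<bar>fps_nth f n\<bar> \<le> c * M ^ n)"

lemma geom_bounded_mono:
  "geom_bounded c M f \<Longrightarrow> 0 \<le> c \<Longrightarrow> 0 \<le> M \<Longrightarrow> M \<le> N \<Longrightarrow> geom_bounded c N f"
  unfolding geom_bounded_def by (meson mult_left_mono order.trans power_mono)

text \<open>The Cauchy product has n + 1 \<le> 2^n terms, so their number is absorbed by doubling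
  the ratio.\<close>

lemma geom_bounded_mult:
  assumes f: "geom_bounded c M f" and g: "geom_bounded d M g" and "0 \<le> c" "0 \<le> d" "0 \<le> M"
  shows "geom_bounded (c * d) (2 * M) (f * g)"
  unfolding geom_bounded_def
proof
  fix n
  have "\<bar>fps_nth (f * g) n\<bar> \<le> (\<Sum>i=0..n. \<bar>fps_nth f i * fps_nth g (n - i)\<bar>)"
    unfolding fps_mult_nth by (rule sum_abs)
  also have "\<dots> \<le> (\<Sum>i=0..n. c * d * M ^ n)"
  proof (rule sum_mono)
    fix i assume i: "i \<in> {0..n}"
    have "\<bar>fps_nth f i * fps_nth g (n - i)\<bar> \<le> (c * M ^ i) * (d * M ^ (n - i))"
      unfolding abs_mult using f g assms(3-5) by (intro mult_mono) (auto simp: geom_bounded_def)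
    also have "\<dots> = c * d * (M ^ i * M ^ (n - i))" by simp
    also have "M ^ i * M ^ (n - i) = M ^ n" using i by (simp flip: power_add)
    finally show "\<bar>fps_nth f i * fps_nth g (n - i)\<bar> \<le> c * d * M ^ n" .
  qed
  also have "\<dots> = real (Suc n) * (c * d * M ^ n)" by simp
  also have "\<dots> \<le> 2 ^ n * (c * d * M ^ n)"
  proof (rule mult_right_mono)
    have "Suc n \<le> 2 ^ n" by (rule Suc_leI, rule less_exp)
    then show "real (Suc n) \<le> 2 ^ n" by (metis of_nat_le_iff of_nat_numeral of_nat_power)
  qed (use assms in simp)
  also have "\<dots> = c * d * (2 * M) ^ n" by (simp add: power_mult_distrib)
  finally show "\<bar>fps_nth (f * g) n\<bar> \<le> c * d * (2 * M) ^ n" .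
qed

lemma geom_bounded_conv_radius:
  assumes "geom_bounded c M f" "M > 0"
  shows "fps_conv_radius f \<ge> ereal (1 / (2 * M))"
proof -
  have "summable (\<lambda>n. fps_nth f n * (1 / (2 * M)) ^ n)"
  proof (rule summable_comparison_test')
    show "summable (\<lambda>n. c * (1 / 2 :: real) ^ n)" by (intro summable_mult summable_geometric) simp
    fix n :: nat
    have "norm (fps_nth f n * (1 / (2 * M)) ^ n) \<le> (c * M ^ n) * (1 / (2 * M)) ^ n"
      using assms by (auto simp: abs_mult geom_bounded_def power_abs intro!: mult_right_mono)
    also have "\<dots> = c * (1 / 2) ^ n"
      using assms by (simp add: power_mult_distrib power_divide)
    finally show "norm (fps_nth f n * (1 / (2 * M)) ^ n) \<le> c * (1 / 2) ^ n" .
  qed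
  from conv_radius_geI[OF this] show ?thesis
    using assms(2) by (simp add: fps_conv_radius_def)
qed

text \<open>For y > 0 the point (0, 0, 1) is nearer than (0, 0, -1), and |\<rho>^2 - 1| \<le>
  \<rho>^2 + 2 y + 1; hence both parameters of \<open>legendre_fps\<close> lie in [-1, 1].\<close>

lemma geom_bounded_gen_fps:
  assumes "z \<in> half_space"
  shows "geom_bounded (1 / sqrt (pole_dist_sq z)) 3 (gen_fps z)"
proof -
  obtain x1 x2 y where z: "z = (x1, x2, y)" by (cases z)
  have y: "y > 0" using assms by (simp add: half_space_def z)
  have D: "pole_dist_sq z > 0" using pole_dist_sq_pos[OF assms] .
  have sq: "x1\<^sup>2 \<ge> 0" "x2\<^sup>2 \<ge> 0" "y\<^sup>2 \<ge> 0" by simp_all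
  have "\<bar>x1\<^sup>2 + x2\<^sup>2 + y\<^sup>2 - 1\<bar> \<le> pole_dist_sq z"
    unfolding abs_le_iff pole_dist_sq_def z using y sq by (simp add: power2_sum)
  then have a: "\<bar>legendre_lin_coeff z\<bar> \<le> 1" using D by (simp add: legendre_lin_coeff_def z)
  have "\<bar>x1\<^sup>2 + x2\<^sup>2 + (y - 1)\<^sup>2\<bar> \<le> pole_dist_sq z"
    unfolding abs_le_iff pole_dist_sq_def z using y sq by (simp add: power2_sum power2_diff)
  then have b: "\<bar>legendre_quad_coeff z\<bar> \<le> 1" using D by (simp add: legendre_quad_coeff_def z)
  show ?thesis
    unfolding geom_bounded_def gen_fps_def
    using abs_legendre_fps_nth_le[OF a b] D by (auto simp: abs_mult intro!: divide_right_mono)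
qed

text \<open>The ratio is 24 = 3 * 2^3: the ratio 3 of G is doubled by each of the two products
  forming G^3 and once more by the factor in front. With D = \<open>pole_dist_sq z\<close>, the
  bound y + 1 \<le> sqrt D turns (y + 1) D^(-3/2) into 1 / D.\<close>

lemma abs_gen_deriv_fps_nth_le:
  assumes "z \<in> half_space"
  shows "\<bar>fps_nth (gen_deriv_fps (0, 0, 1) z) n\<bar> \<le> 24 ^ n / pole_dist_sq z"
proof -
  obtain x1 x2 y where z: "z = (x1, x2, y)" by (cases z)
  have y: "y > 0" using assms by (simp add: half_space_def z)
  have D: "pole_dist_sq z > 0" using pole_dist_sq_pos[OF assms] .
  have yD: "y + 1 \<le> sqrt (pole_dist_sq z)"
    by (rule real_le_rsqrt) (simp add: pole_dist_sq_def z)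
  let ?d = "1 / sqrt (pole_dist_sq z)"
  have "geom_bounded 1 1 (1 - fps_X)"
    by (auto simp: geom_bounded_def fps_X_def)
  moreover have "geom_bounded (y + 1) 1 (lin_fps (0, 0, 1) z)"
    unfolding geom_bounded_def
  proof
    fix n show "\<bar>fps_nth (lin_fps (0, 0, 1) z) n\<bar> \<le> (y + 1) * 1 ^ n"
      using y by (auto simp: lin_fps_def z fps_X_def)
  qed
  ultimately have "geom_bounded (1 * (y + 1)) (2 * 1) ((1 - fps_X) * lin_fps (0, 0, 1) z)"
    using y by (intro geom_bounded_mult) auto
  \<comment> \<open>The product estimate needs a common ratio, so 2 is raised to 12 here, and 3 to 6
    below.\<close>
  then have 1: "geom_bounded (1 * (y + 1)) 12 ((1 - fps_X) * lin_fps (0, 0, 1) z)"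
    using y by (rule_tac geom_bounded_mono) auto
  have g: "geom_bounded ?d 3 (gen_fps z)" by (rule geom_bounded_gen_fps[OF assms])
  have g6: "geom_bounded ?d 6 (gen_fps z)"
    using D by (intro geom_bounded_mono[OF g]) auto
  have g2: "geom_bounded (?d * ?d) 6 (gen_fps z * gen_fps z)"
    using geom_bounded_mult[OF g g] D by simp
  have g3: "geom_bounded (?d * (?d * ?d)) 12 (gen_fps z * (gen_fps z * gen_fps z))"
    using geom_bounded_mult[OF g6 g2] D by simp
  have "geom_bounded (1 * (y + 1) * (?d * (?d * ?d))) 24
      ((1 - fps_X) * lin_fps (0, 0, 1) z * (gen_fps z * (gen_fps z * gen_fps z)))"
    using geom_bounded_mult[OF 1 g3] D y by simp
  then have "\<bar>fps_nth (gen_deriv_fps (0, 0, 1) z) n\<bar> \<le> (y + 1) * (?d * (?d * ?d)) * 24 ^ n"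
    by (simp add: geom_bounded_def gen_deriv_fps_def power3_eq_cube mult.assoc)
  also have "(y + 1) * (?d * (?d * ?d)) \<le> sqrt (pole_dist_sq z) * (?d * (?d * ?d))"
    using yD D by (intro mult_right_mono) auto
  also have "\<dots> = 1 / pole_dist_sq z" using D by simp
  finally show ?thesis using D by (simp add: mult_right_mono)
qed

text \<open>The y-derivative of W^(-1/2) = 1 / ((1 - s) R), where R is the distance to (0, 0, -c)
  and c = (1 + s) / (1 - s).\<close>

definition gen_kernel :: "real \<Rightarrow> R3 \<Rightarrow> real" where
  "gen_kernel s = (\<lambda>(x1, x2, y). - (1 / (1 - s)) *
     ((y + (1 + s) / (1 - s)) / sqrt (x1\<^sup>2 + x2\<^sup>2 + (y + (1 + s) / (1 - s))\<^sup>2) ^ 3))"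

section \<open>Evaluation of the generating series for small s\<close>

lemma eval_lin_fps:
  "eval_fps (lin_fps v z) s = (v \<bullet> z) * (1 - s) + snd (snd v) * (1 + s)"
  and conv_radius_lin_fps: "fps_conv_radius (lin_fps v z) = \<infinity>"
proof -
  have "lin_fps v z = fps_of_poly [:v \<bullet> z + snd (snd v), snd (snd v) - v \<bullet> z:]"
    by (rule fps_ext) (auto simp: lin_fps_def fps_X_def coeff_pCons split: nat.split)
  then show "eval_fps (lin_fps v z) s = (v \<bullet> z) * (1 - s) + snd (snd v) * (1 + s)"
    "fps_conv_radius (lin_fps v z) = \<infinity>"
    by (simp_all add: algebra_simps)
qed

text \<open>Evaluating \<open>gen_fps_square\<close> determines the value up to sign. The bound 1/6
  is half of the inverse of the ratio 3: the series converges there, and the terms after the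
  constant one sum in absolute value to at most 1/2 + 1/4 + ... = 1 times it.\<close>

lemma eval_gen_fps:
  assumes "z \<in> half_space" "\<bar>s\<bar> < 1 / 6"
  shows "eval_fps (gen_fps z) s = 1 / sqrt (\<Sum>i\<in>Basis. eval_fps (lin_fps i z) s ^ 2)"
    and "ereal (norm s) < fps_conv_radius (gen_fps z)"
proof -
  define S where "S = eval_fps (gen_fps z) s"
  define W where "W = (\<Sum>i\<in>Basis. eval_fps (lin_fps i z) s ^ 2)"
  have D: "pole_dist_sq z > 0" using pole_dist_sq_pos[OF assms(1)] .
  have g: "geom_bounded (1 / sqrt (pole_dist_sq z)) 3 (gen_fps z)" by (rule geom_bounded_gen_fps[OF assms(1)])
  have "ereal (norm s) < ereal (1 / (2 * 3))" using assms(2) by simp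
  also have "\<dots> \<le> fps_conv_radius (gen_fps z)" by (rule geom_bounded_conv_radius[OF g]) simp
  finally show cr: "ereal (norm s) < fps_conv_radius (gen_fps z)" .
  have crs: "ereal (norm s) < fps_conv_radius (\<Sum>i\<in>Basis. lin_fps i z ^ 2)"
    and evs: "eval_fps (\<Sum>i\<in>Basis. lin_fps i z ^ 2) s = W"
  proof -
    have inf: "fps_conv_radius (lin_fps i z ^ 2) = \<infinity>" for i
      using fps_conv_radius_power[of "lin_fps i z" 2] by (simp add: conv_radius_lin_fps)
    have add: "fps_conv_radius (f + g) = \<infinity>" if "fps_conv_radius f = \<infinity>" "fps_conv_radius g = \<infinity>" for f g :: "real fps"
      using fps_conv_radius_add[of f g] that by simp
    show "ereal (norm s) < fps_conv_radius (\<Sum>i\<in>Basis. lin_fps i z ^ 2)"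
      by (simp add: Basis_R3 add inf)
    show "eval_fps (\<Sum>i\<in>Basis. lin_fps i z ^ 2) s = W"
      by (simp add: Basis_R3 add inf eval_fps_add eval_fps_power conv_radius_lin_fps W_def)
  qed
  have cr2: "ereal (norm s) < fps_conv_radius (gen_fps z ^ 2)"
    using cr fps_conv_radius_power[of "gen_fps z" 2] by (rule less_le_trans)
  have WS: "W * S\<^sup>2 = 1"
    using arg_cong[OF gen_fps_square[OF assms(1)], of "\<lambda>f. eval_fps f s"]
    unfolding eval_fps_mult[OF crs cr2] evs eval_fps_power[OF cr] by (simp add: S_def)
  \<comment> \<open>The sign of \<open>S\<close>: the constant term dominates the rest of the series.\<close>
  have "(\<lambda>n. fps_nth (gen_fps z) n * s ^ n) sums S"
    unfolding S_def by (rule sums_eval_fps[OF cr])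
  then have tail: "(\<lambda>n. fps_nth (gen_fps z) (Suc n) * s ^ Suc n) sums (S - 1 / sqrt (pole_dist_sq z))"
    by (subst sums_Suc_iff) (simp add: gen_fps_nth_0)
  have geom: "(\<lambda>n. 1 / sqrt (pole_dist_sq z) * (1 / 2) * (1 / 2) ^ n) sums (1 / sqrt (pole_dist_sq z) * (1 / 2) * (1 / (1 - 1 / 2)))"
    by (intro sums_mult geometric_sums) simp
  have le: "fps_nth (gen_fps z) (Suc n) * s ^ Suc n \<ge> - (1 / sqrt (pole_dist_sq z) * (1 / 2) * (1 / 2) ^ n)" for n :: nat
  proof -
    have "\<bar>fps_nth (gen_fps z) (Suc n) * s ^ Suc n\<bar> \<le> (1 / sqrt (pole_dist_sq z) * 3 ^ Suc n) * (1 / 6) ^ Suc n"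
      unfolding abs_mult power_abs
      using g[unfolded geom_bounded_def, rule_format, of "Suc n"] assms(2) D
      by (intro mult_mono power_mono) auto
    also have "\<dots> = 1 / sqrt (pole_dist_sq z) * ((3 * (1 / 6)) ^ Suc n)" unfolding power_mult_distrib by simp
    also have "\<dots> = 1 / sqrt (pole_dist_sq z) * (1 / 2) * (1 / 2) ^ n" by simp
    finally show ?thesis by (simp add: abs_le_iff)
  qed
  have "S - 1 / sqrt (pole_dist_sq z) \<ge> - (1 / sqrt (pole_dist_sq z) * (1 / 2) * (1 / (1 - 1 / 2)))"
    by (rule sums_le[OF le sums_minus[OF geom] tail])
  then have "S \<ge> 0" by simp
  moreover have "W \<noteq> 0" using WS by auto
  then have "S\<^sup>2 = 1 / W" using WS by (simp add: field_simps)
  ultimately have "S = sqrt (1 / W)" by (metis real_sqrt_unique)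
  then show "eval_fps (gen_fps z) s = 1 / sqrt (\<Sum>i\<in>Basis. eval_fps (lin_fps i z) s ^ 2)"
    by (simp add: S_def W_def real_sqrt_divide)
qed

text \<open>The range 1/48 is half of 1/24 and turns the growth 24^n into the decay (1/2)^n.\<close>

lemma abs_gen_deriv_fps_nth_mult_power_le:
  assumes "z \<in> half_space" "\<bar>s\<bar> \<le> 1 / 48"
  shows "\<bar>fps_nth (gen_deriv_fps (0, 0, 1) z) n * s ^ n\<bar> \<le> (1 / 2) ^ n / pole_dist_sq z"
proof -
  have "\<bar>fps_nth (gen_deriv_fps (0, 0, 1) z) n * s ^ n\<bar> \<le> (24 ^ n / pole_dist_sq z) * (1 / 48) ^ n"
    unfolding abs_mult power_abs
    using abs_gen_deriv_fps_nth_le[OF assms(1)] assms(2) pole_dist_sq_pos[OF assms(1)]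
    by (intro mult_mono power_mono) auto
  also have "\<dots> = (24 * (1 / 48)) ^ n / pole_dist_sq z" unfolding power_mult_distrib by simp
  finally show ?thesis by simp
qed

text \<open>No differentiation of an infinite sum is involved: \<open>gen_deriv_fps\<close> is a
  product of known series, and each factor is evaluated separately.\<close>

lemma gen_deriv_fps_sums:
  assumes "z \<in> half_space" "\<bar>s\<bar> \<le> 1 / 48"
  shows "(\<lambda>n. fps_nth (gen_deriv_fps (0, 0, 1) z) n * s ^ n) sums gen_kernel s z"
proof -
  obtain x1 x2 y where z: "z = (x1, x2, y)" by (cases z)
  have s: "\<bar>s\<bar> < 1 / 6" "1 - s > 0" using assms(2) by auto
  define c where "c = (1 + s) / (1 - s)"
  have c: "1 + s = (1 - s) * c" using s by (simp add: c_def)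
  define R where "R = sqrt (x1\<^sup>2 + x2\<^sup>2 + (y + c)\<^sup>2)"
  note cr = eval_gen_fps(2)[OF assms(1) s(1)]
  have cr3: "ereal (norm s) < fps_conv_radius (gen_fps z ^ 3)"
    using cr fps_conv_radius_power[of "gen_fps z" 3] by (rule less_le_trans)
  define L where "L = (1 - fps_X) * lin_fps (0, 0, 1) z"
  have L: "L = fps_of_poly ([:1, -1:] * [:y + 1, 1 - y:])"
    unfolding fps_of_poly_mult L_def
    by (rule arg_cong2[of _ _ _ _ "(*)"]; rule fps_ext)
      (auto simp: lin_fps_def z fps_X_def coeff_pCons split: nat.split)
  then have crL: "ereal (norm s) < fps_conv_radius L" by simp
  have crp: "ereal (norm s) < fps_conv_radius (L * gen_fps z ^ 3)"
    by (rule less_le_trans[OF _ fps_conv_radius_mult]) (use crL cr3 in simp)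
  have evL: "eval_fps L s = (1 - s) * ((1 - s) * (y + c))"
  proof -
    have "eval_fps L s = (1 - s) * (y * (1 - s) + (1 + s))"
      unfolding L eval_fps_of_poly poly_mult by (simp add: algebra_simps)
    also have "\<dots> = (1 - s) * ((1 - s) * (y + c))" unfolding c by (simp add: algebra_simps)
    finally show ?thesis .
  qed
  have W: "(\<Sum>i\<in>Basis. eval_fps (lin_fps i z) s ^ 2) = (1 - s)\<^sup>2 * (x1\<^sup>2 + x2\<^sup>2 + (y + c)\<^sup>2)"
    by (simp add: Basis_R3 eval_lin_fps z c) (simp add: power2_eq_square algebra_simps)
  have "eval_fps (gen_fps z) s = 1 / ((1 - s) * R)"
    unfolding eval_gen_fps(1)[OF assms(1) s(1)] W using s(2) by (simp add: real_sqrt_mult R_def)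
  then have "eval_fps (gen_deriv_fps (0, 0, 1) z) s = - ((1 - s) * ((1 - s) * (y + c)) * (1 / ((1 - s) * R)) ^ 3)"
    unfolding gen_deriv_fps_def L_def[symmetric]
      eval_fps_minus[OF crp] eval_fps_mult[OF crL cr3] evL eval_fps_power[OF cr] by simp
  also have "\<dots> = gen_kernel s z"
    using s(2) unfolding gen_kernel_def z c_def[symmetric] prod.case R_def[symmetric]
    by (simp add: power_divide power_mult_distrib power3_eq_cube)
  finally have ev: "eval_fps (gen_deriv_fps (0, 0, 1) z) s = gen_kernel s z" .
  have "summable (\<lambda>n. fps_nth (gen_deriv_fps (0, 0, 1) z) n * s ^ n)"
  proof (rule summable_comparison_test')
    show "summable (\<lambda>n. 1 / pole_dist_sq z * (1 / 2 :: real) ^ n)" by (intro summable_mult summable_geometric) simp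
    show "norm (fps_nth (gen_deriv_fps (0, 0, 1) z) n * s ^ n) \<le> 1 / pole_dist_sq z * (1 / 2) ^ n" for n
      using abs_gen_deriv_fps_nth_mult_power_le[OF assms, of n] by simp
  qed
  then show ?thesis using ev by (simp add: sums_iff eval_fps_def)
qed

text \<open>This allows the kernel to serve as the second factor \<phi> when sum and integral are
  interchanged.\<close>

lemma abs_gen_kernel_le:
  assumes "z \<in> half_space" "\<bar>s\<bar> \<le> 1 / 48"
  shows "\<bar>gen_kernel s z\<bar> \<le> 2 / pole_dist_sq z"
proof -
  have 1: "(\<lambda>n. 1 / pole_dist_sq z * (1 / 2 :: real) ^ n) sums (1 / pole_dist_sq z * (1 / (1 - 1 / 2)))"
    by (intro sums_mult geometric_sums) simp
  have "norm (\<Sum>n. fps_nth (gen_deriv_fps (0, 0, 1) z) n * s ^ n) \<le> (\<Sum>n. 1 / pole_dist_sq z * (1 / 2) ^ n)"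
    using abs_gen_deriv_fps_nth_mult_power_le[OF assms] by (intro norm_suminf_le sums_summable[OF 1]) simp
  then show ?thesis
    using sums_unique[OF 1] sums_unique[OF gen_deriv_fps_sums[OF assms]] by simp
qed

section \<open>Domination and interchange of sum and integral\<close>

definition half_measure :: "R3 measure" where
  "half_measure = restrict_space lborel half_space"

lemma space_half_measure [simp]: "space half_measure = half_space"
  by (simp add: half_measure_def space_restrict_space)

lemma half_space_borel [measurable]: "half_space \<in> sets borel"
  using open_half_space by simp

lemma borel_measurable_half_measure:
  fixes f :: "R3 \<Rightarrow> real"
  assumes "continuous_on half_space f"
  shows "f \<in> borel_measurable half_measure"
proof -
  have "sets half_measure = sets (restrict_space borel half_space)"
    unfolding half_measure_def by (rule sets_restrict_space_cong) simp
  then show ?thesis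
    using borel_measurable_continuous_on_restrict[OF assms] by (simp cong: measurable_cong_sets)
qed

lemma nn_integral_half_measure:
  fixes f :: "R3 \<Rightarrow> real"
  shows "(\<integral>\<^sup>+z. ennreal (f z) \<partial>half_measure) =
    (\<integral>\<^sup>+(x1, x2, y). ennreal (f (x1, x2, y)) * indicator {0<..} y \<partial>lborel)"
  unfolding half_measure_def
  by (subst nn_integral_restrict_space) (use half_space_borel in simp, auto simp: half_space_def indicator_def intro!: nn_integral_cong)

lemma integrable_inverse_pole_dist4: "integrable half_measure (\<lambda>z. c / (pole_dist_sq z)\<^sup>2)"
proof -
  have meas: "(\<lambda>z. 1 / (pole_dist_sq z)\<^sup>2) \<in> borel_measurable half_measure"
  proof (rule borel_measurable_half_measure)
    show "continuous_on half_space (\<lambda>z. 1 / (pole_dist_sq z)\<^sup>2)"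
      using pole_dist_sq_pos by (intro continuous_intros) force
  qed
  have "(\<integral>\<^sup>+z. ennreal (1 / (pole_dist_sq z)\<^sup>2) \<partial>half_measure) = ennreal pi"
    unfolding nn_integral_half_measure using nn_integral_half_space_inverse_pole_dist4 by (simp add: pole_dist_sq_def)
  then have "integrable half_measure (\<lambda>z. 1 / (pole_dist_sq z)\<^sup>2)"
    by (intro integrableI_nonneg meas) auto
  from integrable_mult_right[OF this, of c] show ?thesis by simp
qed

text \<open>In the norm estimate the constants a and b stand outside the integral, so a = (1/2)^n
  gives a summable sequence of L1 norms.\<close>

lemma integrable_half_measure_mult:
  fixes f g :: "R3 \<Rightarrow> real"
  assumes "f \<in> borel_measurable half_measure" "g \<in> borel_measurable half_measure"
    and "\<And>z. z \<in> half_space \<Longrightarrow> \<bar>f z\<bar> \<le> a / pole_dist_sq z" "\<And>z. z \<in> half_space \<Longrightarrow> \<bar>g z\<bar> \<le> b / pole_dist_sq z"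
  shows "integrable half_measure (\<lambda>z. f z * g z)"
    and "integral\<^sup>L half_measure (\<lambda>z. norm (f z * g z)) \<le> a * b * integral\<^sup>L half_measure (\<lambda>z. 1 / (pole_dist_sq z)\<^sup>2)"
proof -
  have le: "norm (f z * g z) \<le> a * b / (pole_dist_sq z)\<^sup>2" if "z \<in> half_space" for z
  proof -
    have "norm (f z * g z) \<le> (a / pole_dist_sq z) * (b / pole_dist_sq z)"
      unfolding real_norm_def abs_mult using assms(3,4)[OF that]
      by (intro mult_mono abs_ge_zero) (auto intro: order.trans[OF abs_ge_zero])
    then show ?thesis by (simp add: power2_eq_square)
  qed
  show int: "integrable half_measure (\<lambda>z. f z * g z)"
  proof (rule Bochner_Integration.integrable_bound[OF integrable_inverse_pole_dist4[of "a * b"]])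
    show "(\<lambda>z. f z * g z) \<in> borel_measurable half_measure" using assms(1,2) by simp
    show "AE z in half_measure. norm (f z * g z) \<le> norm (a * b / (pole_dist_sq z)\<^sup>2)"
    proof (rule AE_I2)
      fix z assume "z \<in> space half_measure"
      then have "norm (f z * g z) \<le> a * b / (pole_dist_sq z)\<^sup>2" using le by simp
      also have "\<dots> \<le> norm (a * b / (pole_dist_sq z)\<^sup>2)" unfolding real_norm_def by (rule abs_ge_self)
      finally show "norm (f z * g z) \<le> norm (a * b / (pole_dist_sq z)\<^sup>2)" .
    qed
  qed
  have "integral\<^sup>L half_measure (\<lambda>z. norm (f z * g z)) \<le> integral\<^sup>L half_measure (\<lambda>z. a * b / (pole_dist_sq z)\<^sup>2)"
    using int by (intro integral_mono integrable_inverse_pole_dist4 integrable_norm) (use le in auto)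
  also have "\<dots> = integral\<^sup>L half_measure (\<lambda>z. a * b * (1 / (pole_dist_sq z)\<^sup>2))" by simp
  also have "\<dots> = a * b * integral\<^sup>L half_measure (\<lambda>z. 1 / (pole_dist_sq z)\<^sup>2)"
    by (rule integral_mult_right_zero)
  finally show "integral\<^sup>L half_measure (\<lambda>z. norm (f z * g z)) \<le> a * b * integral\<^sup>L half_measure (\<lambda>z. 1 / (pole_dist_sq z)\<^sup>2)" .
qed

lemma borel_measurable_gen_deriv_fps_nth:
  "(\<lambda>z. fps_nth (gen_deriv_fps v z) n) \<in> borel_measurable half_measure"
  using coeffwise_continuous_on_gen_deriv_fps
  by (intro borel_measurable_half_measure) (auto simp: coeffwise_continuous_on_def)

lemma kernel_radius_pos:
  assumes "z \<in> half_space" "\<bar>s\<bar> < 1"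
  shows "(case z of (x1, x2, y) \<Rightarrow> x1\<^sup>2 + x2\<^sup>2 + (y + (1 + s) / (1 - s))\<^sup>2) > 0"
proof -
  obtain x1 x2 y where z: "z = (x1, x2, y)" by (cases z)
  have "y + (1 + s) / (1 - s) > 0" using assms by (auto simp: half_space_def z intro!: add_pos_nonneg)
  then show ?thesis by (auto simp: z intro!: add_nonneg_pos)
qed

lemma borel_measurable_gen_kernel:
  assumes "\<bar>s\<bar> < 1"
  shows "gen_kernel s \<in> borel_measurable half_measure"
proof (rule borel_measurable_half_measure)
  show "continuous_on half_space (gen_kernel s)"
    unfolding gen_kernel_def case_prod_beta using kernel_radius_pos[OF _ assms]
    by (intro continuous_intros) (force simp: case_prod_beta)+
qed

text \<open>The second factor is left general because the interchange is used twice: with \<phi> a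
  kernel \<open>gen_kernel t\<close>, and with \<phi> a single coefficient.\<close>

lemma integral_gen_deriv_fps_sums:
  assumes "\<phi> \<in> borel_measurable half_measure" "\<And>z. z \<in> half_space \<Longrightarrow> \<bar>\<phi> z\<bar> \<le> C / pole_dist_sq z" "\<bar>s\<bar> \<le> 1 / 48"
  shows "(\<lambda>n. integral\<^sup>L half_measure (\<lambda>z. fps_nth (gen_deriv_fps (0, 0, 1) z) n * \<phi> z) * s ^ n) sums
           integral\<^sup>L half_measure (\<lambda>z. gen_kernel s z * \<phi> z)"
proof -
  define e where "e n z = fps_nth (gen_deriv_fps (0, 0, 1) z) n * s ^ n" for n z
  have em: "e n \<in> borel_measurable half_measure" for n
    unfolding e_def using borel_measurable_gen_deriv_fps_nth by simp
  have eb: "\<bar>e n z\<bar> \<le> (1 / 2) ^ n / pole_dist_sq z" if "z \<in> half_space" for n z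
    unfolding e_def using abs_gen_deriv_fps_nth_mult_power_le[OF that assms(3)] .
  have es: "(\<lambda>n. e n z * \<phi> z) sums (gen_kernel s z * \<phi> z)" if "z \<in> half_space" for z
    unfolding e_def by (intro sums_mult2 gen_deriv_fps_sums[OF that assms(3)])
  have "(\<lambda>n. integral\<^sup>L half_measure (\<lambda>z. e n z * \<phi> z)) sums
          integral\<^sup>L half_measure (\<lambda>z. \<Sum>n. e n z * \<phi> z)"
  proof (rule sums_integral)
    show "integrable half_measure (\<lambda>z. e n z * \<phi> z)" for n
      by (rule integrable_half_measure_mult(1)[OF em assms(1) eb assms(2)])
    show "AE z in half_measure. summable (\<lambda>n. norm (e n z * \<phi> z))"
    proof (rule AE_I2)
      fix z assume "z \<in> space half_measure"
      then have z: "z \<in> half_space" by simp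
      show "summable (\<lambda>n. norm (e n z * \<phi> z))"
      proof (rule summable_comparison_test')
        show "summable (\<lambda>n. (1 / 2) ^ n * (1 / pole_dist_sq z * \<bar>\<phi> z\<bar>))"
          by (intro summable_mult2 summable_geometric) simp
        show "norm (norm (e n z * \<phi> z)) \<le> (1 / 2) ^ n * (1 / pole_dist_sq z * \<bar>\<phi> z\<bar>)" for n
          using mult_right_mono[OF eb[OF z, of n], of "\<bar>\<phi> z\<bar>"] by (simp add: abs_mult)
      qed
    qed
    show "summable (\<lambda>n. integral\<^sup>L half_measure (\<lambda>z. norm (e n z * \<phi> z)))"
    proof (rule summable_comparison_test')
      show "summable (\<lambda>n. (1 / 2) ^ n * (C * integral\<^sup>L half_measure (\<lambda>z. 1 / (pole_dist_sq z)\<^sup>2)))"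
        by (intro summable_mult2 summable_geometric) simp
      show "norm (integral\<^sup>L half_measure (\<lambda>z. norm (e n z * \<phi> z)))
         \<le> (1 / 2) ^ n * (C * integral\<^sup>L half_measure (\<lambda>z. 1 / (pole_dist_sq z)\<^sup>2))" for n
        using integrable_half_measure_mult(2)[OF em assms(1) eb assms(2), of n]
        by (simp add: abs_of_nonneg integral_nonneg_AE mult.assoc)
    qed
  qed
  also have "integral\<^sup>L half_measure (\<lambda>z. \<Sum>n. e n z * \<phi> z) = integral\<^sup>L half_measure (\<lambda>z. gen_kernel s z * \<phi> z)"
    by (intro Bochner_Integration.integral_cong) (auto simp: sums_unique[OF es])
  also have "(\<lambda>n. integral\<^sup>L half_measure (\<lambda>z. e n z * \<phi> z)) =
     (\<lambda>n. integral\<^sup>L half_measure (\<lambda>z. fps_nth (gen_deriv_fps (0, 0, 1) z) n * \<phi> z) * s ^ n)"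
  proof
    fix n
    have "integral\<^sup>L half_measure (\<lambda>z. e n z * \<phi> z) =
       integral\<^sup>L half_measure (\<lambda>z. fps_nth (gen_deriv_fps (0, 0, 1) z) n * \<phi> z * s ^ n)"
      by (simp add: e_def mult_ac)
    then show "integral\<^sup>L half_measure (\<lambda>z. e n z * \<phi> z) =
       integral\<^sup>L half_measure (\<lambda>z. fps_nth (gen_deriv_fps (0, 0, 1) z) n * \<phi> z) * s ^ n"
      by (simp only: integral_mult_left_zero)
  qed
  finally show ?thesis .
qed

text \<open>The factors -1 / (1 - s) and -1 / (1 - t) multiply to k, and c + d = 2 (1 - s t) k; so k
  cancels and only the product s t remains.\<close>

lemma integral_gen_kernel_mult:
  assumes "\<bar>s\<bar> < 1" "\<bar>t\<bar> < 1"
  shows "integral\<^sup>L half_measure (\<lambda>z. gen_kernel s z * gen_kernel t z) = pi / 2 / (1 - s * t)"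
proof -
  define c d where "c = (1 + s) / (1 - s)" and "d = (1 + t) / (1 - t)"
  have one_minus: "1 - s \<noteq> 0" "1 - t \<noteq> 0" using assms by auto
  have cd: "c > 0" "d > 0" using assms by (auto simp: c_def d_def)
  have st: "s * t < 1"
  proof -
    have "\<bar>s * t\<bar> < 1" unfolding abs_mult using assms
      by (metis abs_ge_zero mult_strict_mono' mult_1)
    then show ?thesis by simp
  qed
  define k where "k = 1 / ((1 - s) * (1 - t))"
  have k: "k > 0" using assms by (simp add: k_def)
  define P where "P = (\<lambda>(x1, x2, y). (y + c) / sqrt (x1\<^sup>2 + x2\<^sup>2 + (y + c)\<^sup>2) ^ 3 *
             ((y + d) / sqrt (x1\<^sup>2 + x2\<^sup>2 + (y + d)\<^sup>2) ^ 3))"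
  have KP: "gen_kernel s z * gen_kernel t z = k * P z" for z
    by (cases z) (simp add: gen_kernel_def P_def k_def flip: c_def d_def)
  have PK: "P = (\<lambda>z. gen_kernel s z * gen_kernel t z / k)" using k by (auto simp: KP)
  have "P \<in> borel_measurable half_measure"
    unfolding PK using borel_measurable_gen_kernel[OF assms(1)] borel_measurable_gen_kernel[OF assms(2)] by simp
  moreover have "AE z in half_measure. 0 \<le> P z"
    using cd by (intro AE_I2) (auto simp: P_def half_space_def)
  moreover have "(\<integral>\<^sup>+z. ennreal (P z) \<partial>half_measure) = ennreal (pi / (c + d))"
    unfolding nn_integral_half_measure using nn_integral_half_space_Poisson_kernels[OF cd] by (simp add: P_def)
  ultimately have "integral\<^sup>L half_measure P = pi / (c + d)"
    using cd by (simp add: integral_eq_nn_integral)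
  then have "integral\<^sup>L half_measure (\<lambda>z. gen_kernel s z * gen_kernel t z) = k * (pi / (c + d))"
    unfolding KP by simp
  also have "c + d = 2 * (1 - s * t) * k"
    using one_minus by (simp add: c_def d_def k_def divide_simps) (simp add: algebra_simps)
  also have "k * (pi / (2 * (1 - s * t) * k)) = pi / 2 / (1 - s * t)" using k by simp
  finally show ?thesis .
qed

text \<open>Strong induction on n: once the lower differences vanish, dividing the null series by
  s^n and letting s tend to 0 isolates d n.\<close>

lemma powser_coeffs_unique:
  fixes a b :: "nat \<Rightarrow> real"
  assumes "r > 0" "\<And>s. \<bar>s\<bar> \<le> r \<Longrightarrow> (\<lambda>n. a n * s ^ n) sums f s" "\<And>s. \<bar>s\<bar> \<le> r \<Longrightarrow> (\<lambda>n. b n * s ^ n) sums f s"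
  shows "a = b"
proof -
  define d where "d n = a n - b n" for n
  have d: "(\<lambda>n. d n * s ^ n) sums 0" if "\<bar>s\<bar> \<le> r" for s
    using sums_diff[OF assms(2,3)[OF that]] by (simp add: d_def algebra_simps)
  have "d n = 0" for n
  proof (induction n rule: less_induct)
    case (less n)
    have "((\<lambda>_. 0) \<longlongrightarrow> d (0 + n)) (at (0 :: real))"
    proof (rule powser_limit_0_strong[OF assms(1)])
      fix s :: real assume s: "s \<noteq> 0" "norm s < r"
      have "(\<lambda>k. d (k + n) * s ^ (k + n)) sums 0"
        using d[of s] s(2) less by (subst sums_zero_iff_shift) auto
      from sums_mult2[OF this, of "1 / s ^ n"] show "(\<lambda>k. d (k + n) * s ^ k) sums 0"
        using s(1) by (simp add: power_add)
    qed
    moreover have "((\<lambda>_. 0) \<longlongrightarrow> 0) (at (0 :: real))" by simp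
    ultimately show ?case by (metis add_0 tendsto_unique trivial_limit_at)
  qed
  then show ?thesis by (auto simp: d_def)
qed

text \<open>Comparison in the first parameter: t is fixed and 1 / (1 - t s) is expanded in
  s.\<close>

lemma integral_gen_deriv_mult_kernel:
  assumes t: "\<bar>t\<bar> \<le> 1 / 48"
  shows "integral\<^sup>L half_measure (\<lambda>z. fps_nth (gen_deriv_fps (0, 0, 1) z) n * gen_kernel t z) = pi / 2 * t ^ n"
proof -
  have "(\<lambda>n. integral\<^sup>L half_measure (\<lambda>z. fps_nth (gen_deriv_fps (0, 0, 1) z) n * gen_kernel t z)) =
        (\<lambda>n. pi / 2 * t ^ n)"
  proof (rule powser_coeffs_unique[of "1 / 48"])
    fix s :: real assume s: "\<bar>s\<bar> \<le> 1 / 48"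
    have st: "integral\<^sup>L half_measure (\<lambda>z. gen_kernel s z * gen_kernel t z) = pi / 2 * (1 / (1 - t * s))"
      using integral_gen_kernel_mult[of s t] s t by (simp add: mult.commute)
    show "(\<lambda>n. integral\<^sup>L half_measure (\<lambda>z. fps_nth (gen_deriv_fps (0, 0, 1) z) n * gen_kernel t z) * s ^ n)
            sums (pi / 2 * (1 / (1 - t * s)))"
      unfolding st[symmetric]
      using t by (intro integral_gen_deriv_fps_sums[OF borel_measurable_gen_kernel abs_gen_kernel_le s]) auto
    have "\<bar>t * s\<bar> \<le> (1 / 48) * (1 / 48)" unfolding abs_mult using s t by (intro mult_mono) auto
    then have "(\<lambda>n. pi / 2 * (t * s) ^ n) sums (pi / 2 * (1 / (1 - t * s)))"
      by (intro sums_mult geometric_sums) simp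
    then show "(\<lambda>n. pi / 2 * t ^ n * s ^ n) sums (pi / 2 * (1 / (1 - t * s)))"
      by (simp add: power_mult_distrib mult.assoc)
  qed simp
  then show ?thesis by (rule fun_cong)
qed

text \<open>Comparison in the remaining parameter: pi / 2 * s^n, viewed as a power series in s, has
  a single nonzero coefficient.\<close>

lemma integral_gen_deriv_mult:
  "integral\<^sup>L half_measure (\<lambda>z. fps_nth (gen_deriv_fps (0, 0, 1) z) m * fps_nth (gen_deriv_fps (0, 0, 1) z) n) =
     (if m = n then pi / 2 else 0)"
proof -
  have "(\<lambda>m. integral\<^sup>L half_measure (\<lambda>z. fps_nth (gen_deriv_fps (0, 0, 1) z) m * fps_nth (gen_deriv_fps (0, 0, 1) z) n)) =
        (\<lambda>m. if m = n then pi / 2 else 0)"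
  proof (rule powser_coeffs_unique[of "1 / 48"])
    fix s :: real assume s: "\<bar>s\<bar> \<le> 1 / 48"
    have *: "integral\<^sup>L half_measure (\<lambda>z. gen_kernel s z * fps_nth (gen_deriv_fps (0, 0, 1) z) n) = pi / 2 * s ^ n"
      using integral_gen_deriv_mult_kernel[OF s, of n] by (simp add: mult.commute)
    show "(\<lambda>m. integral\<^sup>L half_measure (\<lambda>z. fps_nth (gen_deriv_fps (0, 0, 1) z) m *
          fps_nth (gen_deriv_fps (0, 0, 1) z) n) * s ^ m) sums (pi / 2 * s ^ n)"
      using integral_gen_deriv_fps_sums[OF borel_measurable_gen_deriv_fps_nth abs_gen_deriv_fps_nth_le s, of n]
      unfolding * .
    have "(\<lambda>m. if m = n then pi / 2 * s ^ m else 0) sums (pi / 2 * s ^ n)"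
      using sums_single[of n "\<lambda>m. pi / 2 * s ^ m"] by simp
    then show "(\<lambda>m. (if m = n then pi / 2 else 0) * s ^ m) sums (pi / 2 * s ^ n)"
      by (simp add: if_distrib[of "\<lambda>x. x * _"] cong: if_cong)
  qed simp
  then show ?thesis by (rule fun_cong)
qed

section \<open>Return to the functions u_n\<close>

lemma dy_u_mult_cnj:
  assumes "z \<in> half_space"
  shows "dy (u m) z * cnj (dy (u n) z) = complex_of_real (2 / pi *
    (fps_nth (gen_deriv_fps (0, 0, 1) z) m * fps_nth (gen_deriv_fps (0, 0, 1) z) n))"
proof -
  have "sqrt (2 / pi) * a * (sqrt (2 / pi) * b) = 2 / pi * (a * b)" for a b
  proof -
    have "sqrt (2 / pi) * a * (sqrt (2 / pi) * b) = (sqrt (2 / pi) * sqrt (2 / pi)) * (a * b)"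
      by (simp only: mult_ac)
    then show ?thesis by simp
  qed
  then show ?thesis
    unfolding dy_def dir_deriv_u[OF assms] complex_cnj_complex_of_real of_real_mult[symmetric] by simp
qed

lemma set_integrable_dy_u_mult_cnj:
  "set_integrable lborel half_space (\<lambda>z. dy (u m) z * cnj (dy (u n) z))"
proof -
  have "integrable half_measure (\<lambda>z. complex_of_real (2 / pi *
      (fps_nth (gen_deriv_fps (0, 0, 1) z) m * fps_nth (gen_deriv_fps (0, 0, 1) z) n)))"
    by (intro integrable_of_real integrable_mult_right
        integrable_half_measure_mult(1)[OF borel_measurable_gen_deriv_fps_nth borel_measurable_gen_deriv_fps_nth
          abs_gen_deriv_fps_nth_le abs_gen_deriv_fps_nth_le])
  then have "integrable half_measure (\<lambda>z. dy (u m) z * cnj (dy (u n) z))"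
    by (rule Bochner_Integration.integrable_cong[THEN iffD1, rotated -1]) (simp_all add: dy_u_mult_cnj)
  then show ?thesis
    unfolding half_measure_def set_integrable_def by (subst (asm) integrable_restrict_space) auto
qed

text \<open>The normalization sqrt (2 / pi) enters squared and cancels the pi / 2 on the
  diagonal.\<close>

lemma dirichlet_inner_u: "dirichlet_inner (u m) (u n) = (if m = n then 1 else 0)"
proof -
  have "dirichlet_inner (u m) (u n) = integral\<^sup>L half_measure (\<lambda>z. dy (u m) z * cnj (dy (u n) z))"
    unfolding dirichlet_inner_def half_measure_def set_lebesgue_integral_def
    by (subst integral_restrict_space) auto
  also have "\<dots> = integral\<^sup>L half_measure (\<lambda>z. complex_of_real (2 / pi *
      (fps_nth (gen_deriv_fps (0, 0, 1) z) m * fps_nth (gen_deriv_fps (0, 0, 1) z) n)))"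
    by (intro Bochner_Integration.integral_cong) (simp_all add: dy_u_mult_cnj)
  also have "\<dots> = complex_of_real (2 / pi * (if m = n then pi / 2 else 0))"
    unfolding integral_complex_of_real integral_mult_right_zero integral_gen_deriv_mult ..
  finally show ?thesis by simp
qed

theorem mainTheorem6:
  shows "(\<forall>n. harmonic_on half_space (u n) \<and> u n \<in> dirichlet_space) \<and>
         (\<forall>m n. set_integrable lborel half_space (\<lambda>z. dy (u m) z * cnj (dy (u n) z)) \<and>
                dirichlet_inner (u m) (u n) = (if m = n then 1 else 0))"
proof -
  \<comment> \<open>Membership in the Dirichlet space is the diagonal case m = n, where the product
    with the conjugate is the squared modulus.\<close>
  have "set_integrable lborel half_space (\<lambda>z. (cmod (dy (u n) z))\<^sup>2)" for n
  proof -
    have "integrable lborel (\<lambda>z. Re (indicator half_space z *\<^sub>R (dy (u n) z * cnj (dy (u n) z))))"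
      using set_integrable_dy_u_mult_cnj[of n n] unfolding set_integrable_def by (rule integrable_Re)
    then show ?thesis
      unfolding set_integrable_def by (simp add: complex_norm_square[symmetric] flip: of_real_power)
  qed
  then show ?thesis
    using harmonic_on_u set_integrable_dy_u_mult_cnj dirichlet_inner_u by (simp add: dirichlet_space_def)
qed

end
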